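(* Let $a<b$, let $a=c_0<c_1<\dots<c_r=b$, and suppose $f$ is a real-valued function on $[a,b]$ that has Lipschitz constant bounded by $L>0$ on each interval $(c_j,c_{j+1})$, $0\le j\le r-1$. For an integer $n\ge1$ let $\mathbf{f}\in\mathbb{R}^{n+1}$ have entries $\mathbf{f}[k]=f(a_k)$, where $a_k=a+\frac kn(b-a)$, $0\le k\le n$. Let $\sigma_0,\sigma_1,\dots,\sigma_n,\dots$ be a sequence of positive numbers, and let $Z=(Z[0],\dots,Z[n])$, where $Z[0],Z[1],\dots,Z[n],\dots$ are independent random variables with $Z[j]\sim N(0,\sigma_j^2)$. Suppose that $\sigma>0$ satisfies $$\frac1n\sum_{j=1}^n\sigma_j^2\le\sigma^2$$ for all $n$. Let $Y=\mathbf{f}+Z$. Let $t>0$ and $1\le p\le\infty$. Then for all $n$ sufficiently large, $$\mathbb{P}\left\{\Big|\|Y\|_{\nu_p}-\|f\|_{V^p}\Big|\ge t\right\}\le Ae^{-Bt^2n/\sigma^2},$$ where $A>0$ and $B>0$ are universal constants; $$\lim_{n\to\infty}\|Y\|_{\nu_p}=\|f\|_{V^p}$$ almost surely; and $$\mathbb{E}\Big|\|Y\|_{\nu_p}-\|f\|_{V^p}\Big|\le C\frac{\sigma}{\sqrt n},$$ where $C>0$ is a universal constant. Furthermore, these three statements hold with $f$ replaced by $f_{\mathrm{cen}}$ and $Y$ replaced by $Y_{\mathrm{cen}}$.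
   Context: Volterra $p$-norm: $(\mathcal{V}f)(x)=\int_a^xf(s)\,ds$ and $\|f\|_{V^p}=\|\mathcal{V}f\|_{L^p([a,b])}$. Discrete norms: for $\mathbf{v}\in\mathbb{R}^{n+1}$ (entries indexed $0,\dots,n$), $$\|\mathbf{v}\|_{\tau_p}=\left(\frac{b-a}{2n}\sum_{k=0}^{n-1}\left(|\mathbf{v}[k]|^p+|\mathbf{v}[k+1]|^p\right)\right)^{1/p}\ (1\le p<\infty),\qquad \|\mathbf{v}\|_{\tau_\infty}=\max_{0\le k\le n}|\mathbf{v}[k]|.$$ The discrete Volterra operator $\mathbf{V}:\mathbb{R}^{n+1}\to\mathbb{R}^{n+1}$ is $(\mathbf{V}\mathbf{x})[0]=0$ and $(\mathbf{V}\mathbf{x})[k]=\frac{b-a}{2n}\sum_{j=0}^{k-1}(\mathbf{x}[j]+\mathbf{x}[j+1])$ for $1\le k\le n$; and $\|\mathbf{x}\|_{\nu_p}=\|\mathbf{V}\mathbf{x}\|_{\tau_p}$. Centering: $\mu(f)=\frac1{b-a}\int_a^bf(s)\,ds$ and $f_{\mathrm{cen}}(x)=f(x)-\mu(f)$. For $\mathbf{w}\in\mathbb{R}^{n+1}$, $\mathrm{m}(\mathbf{w})=\frac1{2n}\sum_{k=0}^{n-1}(\mathbf{w}[k]+\mathbf{w}[k+1])$ and $\mathbf{w}_{\mathrm{cen}}[k]=\mathbf{w}[k]-\mathrm{m}(\mathbf{w})$, $0\le k\le n$.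
   Formalization: B and C may depend on the interval [a,b] (A may not): with f=0, p=∞ and σ_j=σ the norm of Z has size (b−a)σ/√n, so universal B and C are impossible; the constants are also stated for each underlying set of the probability space, though only the law of Z matters. *)

theory Defs
  imports "HOL-Probability.Probability"
begin

text \<open>
  A function on \<open>[a,b]\<close> is a total function \<open>real \<Rightarrow> real\<close> of which only the values on
  \<open>{a..b}\<close> matter. A vector in \<open>\<real>\<^sup>n\<^sup>+\<^sup>1\<close> is a function \<open>nat \<Rightarrow> real\<close> of which only the entries
  at \<open>0, \<dots>, n\<close> matter. The exponent \<open>p\<close> ranges over \<open>[1,\<infinity>]\<close> and has type \<open>ennreal\<close>.
\<close>

text \<open>For a non-measurable \<open>g\<close> or an infinite \<open>L\<^sup>p\<close> norm the value below is junk (a real number);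
  this is harmless here, since the definition is only applied to continuous \<open>g\<close>.\<close>

definition Lp_norm :: "real \<Rightarrow> real \<Rightarrow> ennreal \<Rightarrow> (real \<Rightarrow> real) \<Rightarrow> real" where
  "Lp_norm a b p g =
     (if p = \<infinity> then real_of_ereal (esssup (lebesgue_on {a..b}) (\<lambda>x. ereal \<bar>g x\<bar>))
      else (LINT x|lebesgue_on {a..b}. \<bar>g x\<bar> powr enn2real p) powr (1 / enn2real p))"

definition volterra :: "real \<Rightarrow> (real \<Rightarrow> real) \<Rightarrow> real \<Rightarrow> real" where
  "volterra a f x = (LINT s|lebesgue_on {a..x}. f s)"

definition volterra_norm :: "real \<Rightarrow> real \<Rightarrow> ennreal \<Rightarrow> (real \<Rightarrow> real) \<Rightarrow> real" where
  "volterra_norm a b p f = Lp_norm a b p (volterra a f)"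

definition tau_norm :: "real \<Rightarrow> real \<Rightarrow> nat \<Rightarrow> ennreal \<Rightarrow> (nat \<Rightarrow> real) \<Rightarrow> real" where
  "tau_norm a b n p v =
     (if p = \<infinity> then Max ((\<lambda>k. \<bar>v k\<bar>) ` {0..n})
      else ((b - a) / (2 * real n) *
             (\<Sum>k<n. \<bar>v k\<bar> powr enn2real p + \<bar>v (Suc k)\<bar> powr enn2real p)) powr (1 / enn2real p))"

text \<open>For \<open>k = 0\<close> the sum is empty, so entry \<open>0\<close> is \<open>0\<close>.\<close>

definition dvolterra :: "real \<Rightarrow> real \<Rightarrow> nat \<Rightarrow> (nat \<Rightarrow> real) \<Rightarrow> nat \<Rightarrow> real" where
  "dvolterra a b n x k = (b - a) / (2 * real n) * (\<Sum>j<k. x j + x (Suc j))"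

definition nu_norm :: "real \<Rightarrow> real \<Rightarrow> nat \<Rightarrow> ennreal \<Rightarrow> (nat \<Rightarrow> real) \<Rightarrow> real" where
  "nu_norm a b n p x = tau_norm a b n p (dvolterra a b n x)"

definition mean :: "real \<Rightarrow> real \<Rightarrow> (real \<Rightarrow> real) \<Rightarrow> real" where
  "mean a b f = 1 / (b - a) * (LINT s|lebesgue_on {a..b}. f s)"

definition cen :: "real \<Rightarrow> real \<Rightarrow> (real \<Rightarrow> real) \<Rightarrow> real \<Rightarrow> real" where
  "cen a b f x = f x - mean a b f"

definition dmean :: "nat \<Rightarrow> (nat \<Rightarrow> real) \<Rightarrow> real" where
  "dmean n w = 1 / (2 * real n) * (\<Sum>k<n. w k + w (Suc k))"

definition dcen :: "nat \<Rightarrow> (nat \<Rightarrow> real) \<Rightarrow> nat \<Rightarrow> real" where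
  "dcen n w k = w k - dmean n w"

definition sample :: "real \<Rightarrow> real \<Rightarrow> nat \<Rightarrow> (real \<Rightarrow> real) \<Rightarrow> nat \<Rightarrow> real" where
  "sample a b n f k = f (a + real k / real n * (b - a))"

text \<open>The noisy vector: \<open>z\<close> is one realisation of the whole noise sequence, of which the first
  \<open>n + 1\<close> terms are used.\<close>

definition noisy :: "real \<Rightarrow> real \<Rightarrow> nat \<Rightarrow> (real \<Rightarrow> real) \<Rightarrow> (nat \<Rightarrow> real) \<Rightarrow> nat \<Rightarrow> real" where
  "noisy a b n f z k = sample a b n f k + z k"

end

theory Submission
  imports Defs
begin

text \<open>
  Integration averages out independent noise. The discrete Volterra operator turns the data into trapezoid sums of
  the samples plus partial sums of the noise divided by \<open>n\<close>. Partial sums of \<open>n\<close> independent centred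
  Gaussians with average variance at most \<open>\<sigma>\<^sup>2\<close> have size \<open>\<sigma> * sqrt n\<close>, uniformly in the
  summation range, so the noise moves every entry of the Volterra vector by only about \<open>\<sigma> / sqrt n\<close>;
  the trapezoid error for a piecewise Lipschitz function is of the smaller order \<open>1 / n\<close>.

  The proof separates these two effects. The deterministic half, \<open>noisy_volterra_norm_error\<close>, bounds
  the error of the norm, plain or centred, by \<open>(\<kappa> * S + E) / n\<close>. Here \<open>S\<close> is the largest absolute
  partial sum of the noise, \<open>\<kappa>\<close> depends on \<open>a\<close> and \<open>b\<close> alone, and \<open>E\<close> depends on the function. This half
  rests on viewing a vector as a step function that takes at each point the value of the nearest node. Then the
  discrete norm is the \<open>L\<^sup>p\<close> norm of the step function (\<open>tau_norm_eq_Lp_norm_step\<close>), the trapezoid sum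
  is its integral (\<open>has_integral_nearest_node_step\<close>), and Minkowski's inequality
  (\<open>Lp_norm_le_add_const\<close>) turns uniform closeness into closeness of norms, with a constant that does
  not depend on \<open>p\<close>.

  The probabilistic half, \<open>gaussian_walk_controlled_convergence\<close>, draws the three conclusions from
  such a bound. Levy's maximal inequality gives \<open>S\<close> the same Gaussian tail, up to a constant, as the
  last partial sum (\<open>gaussian_walk_maximal\<close>). The tail estimate is then immediate, almost sure
  convergence is Borel-Cantelli, and the bound in mean comes from summing the tail. This gives \<open>A = 4\<close>,
  \<open>B = 1 / (16 \<kappa>\<^sup>2)\<close> and \<open>C = 16 \<kappa> + 1\<close> with \<open>\<kappa> = 3 (b - a) max 1 (b - a)\<close>.
\<close>

section \<open>Maximal inequality for Gaussian random walks\<close>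

text \<open>Split the event that the walk reaches \<open>t\<close> according to the first time \<open>m\<close> at which it does. That
  first passage depends on the increments before \<open>m\<close> only, so with probability at least \<open>1/2\<close>,
  independently of it, the remaining increments do not bring the walk back below \<open>t\<close>. Hence at least
  half of the event is contained in the event that the walk ends at or above \<open>t\<close>.\<close>

lemma (in prob_space) Levy_maximal_inequality:
  fixes X :: "nat \<Rightarrow> 'a \<Rightarrow> real"
  assumes ind: "indep_vars (\<lambda>_. borel) X {..<N}"
    and tail: "\<And>m. m \<le> N \<Longrightarrow> 1 / 2 \<le> prob {\<omega> \<in> space M. 0 \<le> (\<Sum>j\<in>{m..<N}. X j \<omega>)}"
  shows "prob {\<omega> \<in> space M. \<exists>m\<le>N. t \<le> (\<Sum>j<m. X j \<omega>)}
    \<le> 2 * prob {\<omega> \<in> space M. t \<le> (\<Sum>j<N. X j \<omega>)}"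
proof -
  define A where "A m = {\<omega> \<in> space M. t \<le> (\<Sum>j<m. X j \<omega>) \<and> (\<forall>i<m. (\<Sum>j<i. X j \<omega>) < t)}" for m
  define R where "R m = {\<omega> \<in> space M. 0 \<le> (\<Sum>j\<in>{m..<N}. X j \<omega>)}" for m
  have meas: "X j \<in> borel_measurable M" if "j < N" for j
    using ind that by (auto simp: indep_vars_def)
  have sumlt[measurable]: "(\<lambda>\<omega>. \<Sum>j<m. X j \<omega>) \<in> borel_measurable M" if "m \<le> N" for m
    using that by (intro borel_measurable_sum meas) auto
  have [measurable]: "(\<lambda>\<omega>. \<Sum>j\<in>{m..<N}. X j \<omega>) \<in> borel_measurable M" for m
    by (intro borel_measurable_sum meas) auto
  have A_sets: "A m \<in> events" if "m \<le> N" for m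
  proof -
    have "{\<omega> \<in> space M. t \<le> (\<Sum>j<m. X j \<omega>)} \<in> events"
      using sumlt[OF that] by measurable
    moreover have "{\<omega> \<in> space M. \<forall>i\<in>{..<m}. (\<Sum>j<i. X j \<omega>) < t} \<in> events"
    proof (rule sets.sets_Collect_finite_All)
      fix i assume "i \<in> {..<m}"
      then have "i \<le> N" using that by simp
      from sumlt[OF this] show "{\<omega> \<in> space M. (\<Sum>j<i. X j \<omega>) < t} \<in> events" by measurable
    qed auto
    moreover have "A m = {\<omega> \<in> space M. t \<le> (\<Sum>j<m. X j \<omega>)} \<inter> {\<omega> \<in> space M. \<forall>i\<in>{..<m}. (\<Sum>j<i. X j \<omega>) < t}"
      by (auto simp: A_def)
    ultimately show ?thesis by (simp only: sets.Int)
  qed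
  have R_sets[measurable]: "R m \<in> events" for m unfolding R_def by measurable
  \<comment> \<open>The set \<open>A m\<close> is a first passage at time \<open>m\<close>; a walk has at most one.\<close>
  have disj: "disjoint_family_on A {..N}"
    by (auto simp: disjoint_family_on_def A_def) (metis linorder_neqE_nat not_less)
  have indep: "prob (A m \<inter> R m) = prob (A m) * prob (R m)" if "m \<le> N" for m
  proof -
    have iv: "indep_var (PiM {..<m} (\<lambda>_. borel)) (\<lambda>\<omega>. restrict (\<lambda>i. X i \<omega>) {..<m})
                        (PiM {m..<N} (\<lambda>_. borel)) (\<lambda>\<omega>. restrict (\<lambda>i. X i \<omega>) {m..<N})"
      using that by (intro indep_var_restrict[OF ind]) auto
    define SA where "SA = {x \<in> space (PiM {..<m} (\<lambda>_. borel :: real measure)).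
        t \<le> (\<Sum>j<m. x j) \<and> (\<forall>i\<in>{..<m}. (\<Sum>j<i. x j) < t)}"
    define SR where "SR = {x \<in> space (PiM {m..<N} (\<lambda>_. borel :: real measure)). 0 \<le> (\<Sum>j\<in>{m..<N}. x j)}"
    have c: "(\<lambda>x. \<Sum>j<i. x j) \<in> borel_measurable (PiM {..<m} (\<lambda>_. borel :: real measure))" if "i \<le> m" for i
      using that by (intro borel_measurable_sum measurable_component_singleton) auto
    have "SA \<in> sets (PiM {..<m} (\<lambda>_. borel))"
    proof -
      have "{x \<in> space (PiM {..<m} (\<lambda>_. borel :: real measure)). t \<le> (\<Sum>j<m. x j)} \<in> sets (PiM {..<m} (\<lambda>_. borel))"
        using c[OF order_refl] by measurable
      moreover have "{x \<in> space (PiM {..<m} (\<lambda>_. borel :: real measure)). \<forall>i\<in>{..<m}. (\<Sum>j<i. x j) < t} \<in> sets (PiM {..<m} (\<lambda>_. borel))"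
      proof (rule sets.sets_Collect_finite_All)
        fix i assume "i \<in> {..<m}"
        then have "i \<le> m" by simp
        from c[OF this] show "{x \<in> space (PiM {..<m} (\<lambda>_. borel :: real measure)). (\<Sum>j<i. x j) < t} \<in> sets (PiM {..<m} (\<lambda>_. borel))"
          by measurable
      qed auto
      moreover have "SA = {x \<in> space (PiM {..<m} (\<lambda>_. borel :: real measure)). t \<le> (\<Sum>j<m. x j)} \<inter>
         {x \<in> space (PiM {..<m} (\<lambda>_. borel :: real measure)). \<forall>i\<in>{..<m}. (\<Sum>j<i. x j) < t}"
        by (auto simp: SA_def)
      ultimately show ?thesis by (simp only: sets.Int)
    qed
    moreover have "SR \<in> sets (PiM {m..<N} (\<lambda>_. borel))"
      unfolding SR_def by measurable
    moreover have "(\<lambda>\<omega>. restrict (\<lambda>i. X i \<omega>) {..<m}) -` SA \<inter> space M = A m"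
    proof -
      have "(\<Sum>j<i. restrict (\<lambda>i. X i \<omega>) {..<m} j) = (\<Sum>j<i. X j \<omega>)" if "i \<le> m" for i \<omega>
        using that by (intro sum.cong) auto
      then show ?thesis
        by (auto simp: SA_def A_def space_PiM simp del: restrict_apply)
    qed
    moreover have "(\<lambda>\<omega>. restrict (\<lambda>i. X i \<omega>) {m..<N}) -` SR \<inter> space M = R m"
      by (auto simp: SR_def R_def space_PiM)
    moreover have "(\<lambda>\<omega>. (restrict (\<lambda>i. X i \<omega>) {..<m}, restrict (\<lambda>i. X i \<omega>) {m..<N})) -` (SA \<times> SR) \<inter> space M = A m \<inter> R m"
      using calculation(3,4) by auto
    ultimately show ?thesis using indep_varD[OF iv, of SA SR] by simp
  qed
  have "{\<omega> \<in> space M. \<exists>m\<le>N. t \<le> (\<Sum>j<m. X j \<omega>)} = (\<Union>m\<in>{..N}. A m)" (is "?L = _")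
  proof (intro equalityI subsetI)
    fix \<omega> assume w: "\<omega> \<in> ?L"
    define m where "m = (LEAST m. t \<le> (\<Sum>j<m. X j \<omega>))"
    obtain k where k: "k \<le> N" "t \<le> (\<Sum>j<k. X j \<omega>)" using w by auto
    have "t \<le> (\<Sum>j<m. X j \<omega>)" "m \<le> k" unfolding m_def using k(2) by (rule LeastI, rule Least_le)
    moreover have "(\<Sum>j<i. X j \<omega>) < t" if "i < m" for i
      using not_less_Least[of i] that unfolding m_def by (meson not_le)
    ultimately show "\<omega> \<in> (\<Union>m\<in>{..N}. A m)" using k w by (auto simp: A_def)
  qed (auto simp: A_def)
  also have "prob (\<Union>m\<in>{..N}. A m) = (\<Sum>m\<le>N. prob (A m))"
    using A_sets disj by (intro finite_measure_finite_Union) auto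
  also have "\<dots> \<le> (\<Sum>m\<le>N. 2 * prob (A m \<inter> R m))"
  proof (rule sum_mono)
    fix m assume "m \<in> {..N}"
    then have "prob (A m) * (1/2) \<le> prob (A m) * prob (R m)"
      using tail[of m] by (intro mult_left_mono) (auto simp: R_def)
    then show "prob (A m) \<le> 2 * prob (A m \<inter> R m)" using indep[of m] \<open>m \<in> {..N}\<close> by simp
  qed
  also have "\<dots> = 2 * prob (\<Union>m\<in>{..N}. A m \<inter> R m)"
    using A_sets disj
    by (subst finite_measure_finite_Union) (auto simp: disjoint_family_on_def sum_distrib_left)
  also have "\<dots> \<le> 2 * prob {\<omega> \<in> space M. t \<le> (\<Sum>j<N. X j \<omega>)}"
  proof -
    have "A m \<inter> R m \<subseteq> {\<omega> \<in> space M. t \<le> (\<Sum>j<N. X j \<omega>)}" if "m \<le> N" for m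
    proof
      fix \<omega> assume w: "\<omega> \<in> A m \<inter> R m"
      have "(\<Sum>j<N. X j \<omega>) = (\<Sum>j<m. X j \<omega>) + (\<Sum>j\<in>{m..<N}. X j \<omega>)"
        using sum.atLeastLessThan_concat[of 0 m N "\<lambda>j. X j \<omega>"] that by (simp add: atLeast0LessThan)
      with w show "\<omega> \<in> {\<omega> \<in> space M. t \<le> (\<Sum>j<N. X j \<omega>)}" by (auto simp: A_def R_def)
    qed
    moreover have "{\<omega> \<in> space M. t \<le> (\<Sum>j<N. X j \<omega>)} \<in> events"
      using sumlt[OF order_refl] by measurable
    ultimately show ?thesis by (intro mult_left_mono finite_measure_mono) auto
  qed
  finally show ?thesis .
qed

text \<open>For \<open>x \<ge> t \<ge> 0\<close> one has \<open>x\<^sup>2 \<ge> t\<^sup>2 + (x - t)\<^sup>2\<close>, so beyond \<open>t\<close> the centred density lies below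
  \<open>exp (- t\<^sup>2 / (2 s\<^sup>2))\<close> times the normal density with mean \<open>t\<close>, whose mass is \<open>1\<close>.\<close>

lemma (in prob_space) normal_tail:
  assumes D: "distributed M lborel X (normal_density 0 s)" and s: "0 < s" and t: "0 \<le> t"
  shows "prob {\<omega> \<in> space M. t \<le> X \<omega>} \<le> exp (- t\<^sup>2 / (2 * s\<^sup>2))"
proof -
  have "emeasure M {\<omega> \<in> space M. t \<le> X \<omega>} = (\<integral>\<^sup>+x. ennreal (normal_density 0 s x) * indicator {t..} x \<partial>lborel)"
    using distributed_emeasure[OF D, of "{t..}"] by (auto simp: vimage_def Int_def conj_commute)
  also have "\<dots> \<le> (\<integral>\<^sup>+x. ennreal (exp (- t\<^sup>2 / (2 * s\<^sup>2)) * normal_density t s x) \<partial>lborel)"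
  proof (rule nn_integral_mono)
    fix x :: real
    have "normal_density 0 s x \<le> exp (- t\<^sup>2 / (2 * s\<^sup>2)) * normal_density t s x" if "t \<le> x"
    proof -
      have "0 \<le> t * (x - t)" using that t by simp
      then have "t\<^sup>2 + (x - t)\<^sup>2 \<le> x\<^sup>2" by (simp add: power2_eq_square algebra_simps)
      then have "- x\<^sup>2 / (2 * s\<^sup>2) \<le> - t\<^sup>2 / (2 * s\<^sup>2) + - (x - t)\<^sup>2 / (2 * s\<^sup>2)"
        using s by (simp add: divide_simps)
      then have "exp (- x\<^sup>2 / (2 * s\<^sup>2)) \<le> exp (- t\<^sup>2 / (2 * s\<^sup>2)) * exp (- (x - t)\<^sup>2 / (2 * s\<^sup>2))"
        by (simp flip: exp_add)
      from mult_left_mono[OF this, of "1 / sqrt (2 * pi * s\<^sup>2)"] show ?thesis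
        by (simp add: normal_density_def ac_simps)
    qed
    then show "ennreal (normal_density 0 s x) * indicator {t..} x
        \<le> ennreal (exp (- t\<^sup>2 / (2 * s\<^sup>2)) * normal_density t s x)"
      by (auto simp: indicator_def intro!: ennreal_leI)
  qed
  also have "\<dots> = ennreal (exp (- t\<^sup>2 / (2 * s\<^sup>2)))"
    using s by (simp add: ennreal_mult nn_integral_cmult nn_integral_eq_integral integrable_normal_density integral_normal_density)
  finally show ?thesis by (simp add: emeasure_eq_measure)
qed

text \<open>\<open>X\<close> and \<open>- X\<close> have the same law, and one of them is nonnegative at every point.\<close>

lemma (in prob_space) normal_nonneg_half:
  assumes D: "distributed M lborel X (normal_density 0 s)" and s: "0 < s"
  shows "1 / 2 \<le> prob {\<omega> \<in> space M. 0 \<le> X \<omega>}"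
proof -
  have D': "distributed M lborel (\<lambda>\<omega>. 0 + (-1) * X \<omega>) (normal_density 0 s)"
    using normal_density_affine[OF D s, of "-1" 0] by simp
  have [measurable]: "X \<in> borel_measurable M" using distributed_measurable[OF D] by simp
  have "prob {\<omega> \<in> space M. 0 \<le> X \<omega>} = prob {\<omega> \<in> space M. 0 \<le> - X \<omega>}"
    using distributed_emeasure[OF D, of "{0..}"] distributed_emeasure[OF D', of "{0..}"]
    by (simp add: vimage_def Int_def conj_commute measure_def)
  moreover have "1 \<le> prob {\<omega> \<in> space M. 0 \<le> X \<omega>} + prob {\<omega> \<in> space M. 0 \<le> - X \<omega>}"
  proof -
    have "space M = {\<omega> \<in> space M. 0 \<le> X \<omega>} \<union> {\<omega> \<in> space M. 0 \<le> - X \<omega>}" by auto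
    then have "1 = prob ({\<omega> \<in> space M. 0 \<le> X \<omega>} \<union> {\<omega> \<in> space M. 0 \<le> - X \<omega>})" using prob_space by metis
    also have "\<dots> \<le> prob {\<omega> \<in> space M. 0 \<le> X \<omega>} + prob {\<omega> \<in> space M. 0 \<le> - X \<omega>}"
      by (rule measure_Un_le) measurable
    finally show ?thesis .
  qed
  ultimately show ?thesis by simp
qed

lemma (in prob_space) gaussian_walk_one_sided:
  fixes Z :: "nat \<Rightarrow> 'a \<Rightarrow> real"
  assumes ind: "indep_vars (\<lambda>_. borel) Z UNIV"
    and nor: "\<And>j. distributed M lborel (Z j) (normal_density 0 (s j))"
    and s: "\<And>j. 0 < s j" and N: "0 < N" and t: "0 \<le> t"
  shows "prob {\<omega> \<in> space M. \<exists>m\<le>N. t \<le> (\<Sum>j<m. Z j \<omega>)} \<le> 2 * exp (- t\<^sup>2 / (2 * (\<Sum>j<N. (s j)\<^sup>2)))"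
proof -
  have sumD: "distributed M lborel (\<lambda>\<omega>. \<Sum>j\<in>I. Z j \<omega>) (normal_density 0 (sqrt (\<Sum>j\<in>I. (s j)\<^sup>2)))"
    and pos: "0 < sqrt (\<Sum>j\<in>I. (s j)\<^sup>2)"
    if "finite I" "I \<noteq> {}" for I
    using sum_indep_normal[OF that indep_vars_subset[OF ind], of s "\<lambda>_. 0"] nor s that
      sum_pos[OF that, of "\<lambda>j. (s j)\<^sup>2"] by (simp_all add: less_imp_neq[THEN not_sym])
  have "prob {\<omega> \<in> space M. \<exists>m\<le>N. t \<le> (\<Sum>j<m. Z j \<omega>)}
    \<le> 2 * prob {\<omega> \<in> space M. t \<le> (\<Sum>j<N. Z j \<omega>)}"
  proof (rule Levy_maximal_inequality)
    show "indep_vars (\<lambda>_. borel) Z {..<N}" using indep_vars_subset[OF ind] by simp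
    fix m assume "m \<le> N"
    show "1 / 2 \<le> prob {\<omega> \<in> space M. 0 \<le> (\<Sum>j\<in>{m..<N}. Z j \<omega>)}"
    proof (cases "m = N")
      case True then show ?thesis by (simp add: prob_space)
    next
      case False
      with \<open>m \<le> N\<close> show ?thesis by (intro normal_nonneg_half[OF sumD pos]) auto
    qed
  qed
  also have "\<dots> \<le> 2 * exp (- t\<^sup>2 / (2 * (\<Sum>j<N. (s j)\<^sup>2)))"
    using normal_tail[OF sumD pos t, of "{..<N}"] N by (simp add: sum_nonneg lessThan_empty_iff)
  finally show ?thesis .
qed

text \<open>The one-sided bound applies to the walk and to its reflection. What matters below is that a maximum
  over \<open>N\<close> times costs only a constant factor, where a union bound would cost a factor \<open>N\<close>.\<close>

lemma (in prob_space) gaussian_walk_maximal: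
  fixes Z :: "nat \<Rightarrow> 'a \<Rightarrow> real"
  assumes ind: "indep_vars (\<lambda>_. borel) Z UNIV"
    and nor: "\<And>j. distributed M lborel (Z j) (normal_density 0 (s j))"
    and s: "\<And>j. 0 < s j" and N: "0 < N" and t: "0 \<le> t"
  shows "prob {\<omega> \<in> space M. \<exists>m\<le>N. t \<le> \<bar>\<Sum>j<m. Z j \<omega>\<bar>} \<le> 4 * exp (- t\<^sup>2 / (2 * (\<Sum>j<N. (s j)\<^sup>2)))"
proof -
  have meas[measurable]: "Z j \<in> borel_measurable M" for j
    using ind by (auto simp: indep_vars_def)
  have ind': "indep_vars (\<lambda>_. borel) (\<lambda>j \<omega>. - Z j \<omega>) UNIV"
    using indep_vars_compose2[OF ind, of "\<lambda>_ x. - x" "\<lambda>_. borel"] by simp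
  have nor': "distributed M lborel (\<lambda>\<omega>. - Z j \<omega>) (normal_density 0 (s j))" for j
    using normal_density_affine[OF nor s, of "-1" 0 j] by simp
  have "{\<omega> \<in> space M. \<exists>m\<le>N. t \<le> \<bar>\<Sum>j<m. Z j \<omega>\<bar>} =
     {\<omega> \<in> space M. \<exists>m\<le>N. t \<le> (\<Sum>j<m. Z j \<omega>)} \<union> {\<omega> \<in> space M. \<exists>m\<le>N. t \<le> (\<Sum>j<m. - Z j \<omega>)}"
    by (auto simp: abs_if sum_negf split: if_splits)
  also have "prob \<dots> \<le> prob {\<omega> \<in> space M. \<exists>m\<le>N. t \<le> (\<Sum>j<m. Z j \<omega>)} + prob {\<omega> \<in> space M. \<exists>m\<le>N. t \<le> (\<Sum>j<m. - Z j \<omega>)}"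
    by (rule measure_Un_le) measurable
  also have "\<dots> \<le> 4 * exp (- t\<^sup>2 / (2 * (\<Sum>j<N. (s j)\<^sup>2)))"
    using gaussian_walk_one_sided[OF ind nor s N t] gaussian_walk_one_sided[OF ind' nor' s N t] by simp
  finally show ?thesis .
qed

section \<open>Convergence of quantities controlled by a Gaussian walk\<close>

text \<open>The layer-cake bound on a grid of mesh \<open>w\<close>: a nonnegative \<open>X\<close> is at most \<open>w\<close> times the number of
  \<open>i\<close> with \<open>i * w \<le> X\<close>, and the geometric tail sums to \<open>2 * A\<close>.\<close>

lemma (in prob_space) expectation_le_of_geometric_tail:
  fixes X :: "'a \<Rightarrow> real"
  assumes [measurable]: "X \<in> borel_measurable M" and nn: "\<And>\<omega>. \<omega> \<in> space M \<Longrightarrow> 0 \<le> X \<omega>"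
    and w: "0 < w" and tail: "\<And>i::nat. prob {\<omega> \<in> space M. real i * w \<le> X \<omega>} \<le> A * (1 / 2) ^ i"
  shows "integrable M X" and "expectation X \<le> 2 * A * w"
proof -
  have sums: "(\<lambda>i. A * (1 / 2) ^ i) sums (2 * A)"
    using sums_mult[OF geometric_sums[of "1/2::real"], of A] by (simp add: mult.commute)
  have A: "0 \<le> A" using tail[of 0] order_trans[OF measure_nonneg] by fastforce
  have "(\<integral>\<^sup>+\<omega>. ennreal (X \<omega>) \<partial>M) \<le> (\<integral>\<^sup>+\<omega>. (\<Sum>i. ennreal w * indicator {\<omega> \<in> space M. real i * w \<le> X \<omega>} \<omega>) \<partial>M)"
  proof (rule nn_integral_mono)
    fix \<omega> assume w': "\<omega> \<in> space M"
    let ?k = "nat \<lfloor>X \<omega> / w\<rfloor>"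
    have k: "real i * w \<le> X \<omega>" if "i \<le> ?k" for i
    proof -
      have "real i \<le> X \<omega> / w" using that nn[OF w'] w by (simp add: le_nat_iff le_floor_iff)
      then show ?thesis using w by (simp add: field_simps)
    qed
    have "X \<omega> / w \<le> real (Suc ?k)" by linarith
    then have "X \<omega> \<le> w * real (Suc ?k)" using w by (simp add: field_simps)
    then have "ennreal (X \<omega>) \<le> ennreal (w * real (Suc ?k))" by (rule ennreal_leI)
    also have "\<dots> = (\<Sum>i\<le>?k. ennreal w)"
      using w by (simp add: ennreal_mult' ennreal_of_nat_eq_real_of_nat mult.commute)
    also have "\<dots> = (\<Sum>i\<le>?k. ennreal w * indicator {\<omega> \<in> space M. real i * w \<le> X \<omega>} \<omega>)"
      using k w' by (intro sum.cong) auto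
    also have "\<dots> \<le> (\<Sum>i. ennreal w * indicator {\<omega> \<in> space M. real i * w \<le> X \<omega>} \<omega>)"
      by (intro sum_le_suminf) auto
    finally show "ennreal (X \<omega>) \<le> (\<Sum>i. ennreal w * indicator {\<omega> \<in> space M. real i * w \<le> X \<omega>} \<omega>)" .
  qed
  also have "\<dots> = (\<Sum>i. ennreal w * emeasure M {\<omega> \<in> space M. real i * w \<le> X \<omega>})"
    by (subst nn_integral_suminf) (auto simp: nn_integral_cmult_indicator)
  also have "\<dots> \<le> (\<Sum>i. ennreal (w * (A * (1 / 2) ^ i)))"
  proof (intro suminf_le)
    fix i
    have "ennreal w * emeasure M {\<omega> \<in> space M. real i * w \<le> X \<omega>}
        = ennreal (w * prob {\<omega> \<in> space M. real i * w \<le> X \<omega>})"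
      using w by (simp add: emeasure_eq_measure ennreal_mult)
    also have "\<dots> \<le> ennreal (w * (A * (1 / 2) ^ i))"
      using tail[of i] w by (intro ennreal_leI mult_left_mono) auto
    finally show "ennreal w * emeasure M {\<omega> \<in> space M. real i * w \<le> X \<omega>}
        \<le> ennreal (w * (A * (1 / 2) ^ i))" .
  qed auto
  also have "\<dots> = ennreal (w * (2 * A))"
    using sums_mult[OF sums, of w] w A by (intro suminf_ennreal_eq) auto
  finally have le: "(\<integral>\<^sup>+\<omega>. ennreal (X \<omega>) \<partial>M) \<le> ennreal (w * (2 * A))" .
  show int: "integrable M X"
    using le_less_trans[OF le ennreal_less_top] nn by (intro integrableI_nonneg AE_I2) auto
  have "ennreal (expectation X) \<le> ennreal (w * (2 * A))"
    using le nn_integral_eq_integral[OF int] nn by simp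
  then show "expectation X \<le> 2 * A * w" using w A by (simp add: ac_simps)
qed

text \<open>All the probability in the theorem. The quantity \<open>X n\<close> misses its target \<open>x\<close> by at most a multiple
  of (maximal noise sum) \<open>/ n\<close>, plus a deterministic \<open>E / n\<close>. The maximal sum has Gaussian tails at
  scale \<open>\<sigma> * sqrt n\<close>, so its contribution has scale \<open>\<sigma> / sqrt n\<close>, and \<open>E / n\<close> is eventually negligible
  against \<open>t\<close> and against \<open>\<sigma> / sqrt n\<close>. How large \<open>n\<close> must be depends on \<open>E\<close>, \<open>t\<close>, \<open>\<sigma>\<close> and the
  variance of \<open>Z 0\<close>, while the constants depend on \<open>\<kappa>\<close> alone. Almost sure convergence follows from
  the first Borel-Cantelli lemma, since the tail bound is geometric in \<open>n\<close>.\<close>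

lemma (in prob_space) gaussian_walk_controlled_convergence:
  fixes Z :: "nat \<Rightarrow> 'a \<Rightarrow> real" and X :: "nat \<Rightarrow> 'a \<Rightarrow> real" and x :: real
  assumes ind: "indep_vars (\<lambda>_. borel) Z UNIV"
    and nor: "\<And>j. distributed M lborel (Z j) (normal_density 0 (s j))"
    and s: "\<And>j. 0 < s j" and \<sigma>: "0 < \<sigma>"
    and var: "\<And>n. 1 \<le> n \<Longrightarrow> 1 / real n * (\<Sum>j=1..n. (s j)\<^sup>2) \<le> \<sigma>\<^sup>2"
    and \<kappa>: "0 < \<kappa>"
    and X: "\<And>n. X n \<in> borel_measurable M"
    and Xle: "\<And>n \<omega> S. 1 \<le> n \<Longrightarrow> (\<And>m. m \<le> Suc n \<Longrightarrow> \<bar>\<Sum>j<m. Z j \<omega>\<bar> \<le> S)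
        \<Longrightarrow> \<bar>X n \<omega> - x\<bar> \<le> (\<kappa> * S + E) / real n"
  shows "(\<forall>t>0. \<forall>\<^sub>F n in sequentially. prob {\<omega> \<in> space M. t \<le> \<bar>X n \<omega> - x\<bar>}
        \<le> 4 * exp (- (1 / (16 * \<kappa>\<^sup>2)) * t\<^sup>2 * real n / \<sigma>\<^sup>2)) \<and>
    (AE \<omega> in M. (\<lambda>n. X n \<omega>) \<longlonglongrightarrow> x) \<and>
    (\<forall>\<^sub>F n in sequentially. integrable M (\<lambda>\<omega>. \<bar>X n \<omega> - x\<bar>) \<and>
      expectation (\<lambda>\<omega>. \<bar>X n \<omega> - x\<bar>) \<le> (16 * \<kappa> + 1) * (\<sigma> / sqrt (real n)))"
proof -
  define R where "R n \<omega> = X n \<omega> - x" for n \<omega>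
  have [measurable]: "R n \<in> borel_measurable M" for n
    using X[of n] unfolding R_def by measurable
  define Mx where "Mx n \<omega> = Max ((\<lambda>m. \<bar>\<Sum>j<m. Z j \<omega>\<bar>) ` {..Suc n})" for n \<omega>
  have [measurable]: "Z j \<in> borel_measurable M" for j
    using ind by (auto simp: indep_vars_def)
  have Mx_meas[measurable]: "Mx n \<in> borel_measurable M" for n
    unfolding Mx_def by measurable
  have Mx_ge: "\<bar>\<Sum>j<m. Z j \<omega>\<bar> \<le> Mx n \<omega>" if "m \<le> Suc n" for m n \<omega>
    unfolding Mx_def using that by (intro Max_ge) auto
  have Mx_nn: "0 \<le> Mx n \<omega>" for n \<omega> using Mx_ge[of 0 n \<omega>] by simp
  have R_Mx: "\<bar>R n \<omega>\<bar> \<le> (\<kappa> * Mx n \<omega> + E) / real n" if "1 \<le> n" for n \<omega>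
    using Xle[OF that Mx_ge] by (simp add: R_def)
  \<comment> \<open>The assumed variance bound does not cover \<open>Z 0\<close>; once \<open>n\<close> is large its variance is at most
    \<open>n * \<sigma>\<^sup>2\<close>, which makes the total variance at most \<open>2 * n * \<sigma>\<^sup>2\<close>.\<close>
  have Mx_tail: "prob {\<omega> \<in> space M. u \<le> Mx n \<omega>} \<le> 4 * exp (- u\<^sup>2 / (4 * real n * \<sigma>\<^sup>2))"
    if n: "1 \<le> n" "(s 0)\<^sup>2 / \<sigma>\<^sup>2 \<le> real n" and u: "0 \<le> u" for n u
  proof -
    have "{\<omega> \<in> space M. u \<le> Mx n \<omega>} = {\<omega> \<in> space M. \<exists>m\<le>Suc n. u \<le> \<bar>\<Sum>j<m. Z j \<omega>\<bar>}"
      by (auto simp: Mx_def Max_ge_iff)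
    then have "prob {\<omega> \<in> space M. u \<le> Mx n \<omega>} \<le> 4 * exp (- u\<^sup>2 / (2 * (\<Sum>j<Suc n. (s j)\<^sup>2)))"
      using gaussian_walk_maximal[OF ind nor s _ u, of "Suc n"] by simp
    also have "\<dots> \<le> 4 * exp (- u\<^sup>2 / (4 * real n * \<sigma>\<^sup>2))"
    proof -
      have "(\<Sum>j<Suc n. (s j)\<^sup>2) = (s 0)\<^sup>2 + (\<Sum>j=1..n. (s j)\<^sup>2)"
      proof -
        have "{..<Suc n} = insert 0 {1..n}" by auto
        then show ?thesis by simp
      qed
      also have "(s 0)\<^sup>2 \<le> real n * \<sigma>\<^sup>2" using n \<sigma> by (simp add: field_simps)
      also have "(\<Sum>j=1..n. (s j)\<^sup>2) \<le> real n * \<sigma>\<^sup>2"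
        using var[OF n(1)] n by (simp add: field_simps)
      finally have "(\<Sum>j<Suc n. (s j)\<^sup>2) \<le> 2 * real n * \<sigma>\<^sup>2" by simp
      moreover have "0 < (\<Sum>j<Suc n. (s j)\<^sup>2)" using s[of 0] by (intro sum_pos2[of _ 0]) auto
      ultimately have "u\<^sup>2 / (2 * (2 * real n * \<sigma>\<^sup>2)) \<le> u\<^sup>2 / (2 * (\<Sum>j<Suc n. (s j)\<^sup>2))"
        using n(1) \<sigma> by (intro divide_left_mono mult_pos_pos) (auto simp del: sum.lessThan_Suc)
      then show ?thesis by simp
    qed
    finally show ?thesis .
  qed
  have large: "\<forall>\<^sub>F n in sequentially. 1 \<le> n \<and> (s 0)\<^sup>2 / \<sigma>\<^sup>2 \<le> real n"
    using filterlim_real_sequentially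
    by (auto simp: filterlim_at_top intro!: eventually_conj eventually_ge_at_top)
  have E_small: "\<forall>\<^sub>F n in sequentially. E / real n \<le> u" if "0 < u" for u
  proof -
    have "(\<lambda>n. E / real n) \<longlonglongrightarrow> 0" by (rule lim_const_over_n)
    then have "\<forall>\<^sub>F n in sequentially. E / real n < u" using that by (rule order_tendstoD)
    then show ?thesis by eventually_elim simp
  qed
  have tail: "\<forall>\<^sub>F n in sequentially. prob {\<omega> \<in> space M. t \<le> \<bar>R n \<omega>\<bar>}
      \<le> 4 * exp (- (1 / (16 * \<kappa>\<^sup>2)) * t\<^sup>2 * real n / \<sigma>\<^sup>2)" if t: "0 < t" for t
  proof -
    have "\<forall>\<^sub>F n in sequentially. E / real n \<le> t / 2" using E_small[of "t/2"] t by simp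
    with large show ?thesis
    proof eventually_elim
      case (elim n)
      \<comment> \<open>Half of \<open>t\<close> absorbs \<open>E / n\<close>; the other half must come from the noise.\<close>
      let ?u = "real n * t / (2 * \<kappa>)"
      have "prob {\<omega> \<in> space M. t \<le> \<bar>R n \<omega>\<bar>} \<le> prob {\<omega> \<in> space M. ?u \<le> Mx n \<omega>}"
      proof (rule finite_measure_mono)
        show "{\<omega> \<in> space M. t \<le> \<bar>R n \<omega>\<bar>} \<subseteq> {\<omega> \<in> space M. ?u \<le> Mx n \<omega>}"
        proof safe
          fix \<omega> assume "\<omega> \<in> space M" "t \<le> \<bar>R n \<omega>\<bar>"
          then have "t \<le> (\<kappa> * Mx n \<omega> + E) / real n" using R_Mx[of n \<omega>] elim by simp
          then have "t \<le> \<kappa> * Mx n \<omega> / real n + E / real n" by (simp only: add_divide_distrib)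
          then have "t / 2 \<le> \<kappa> * Mx n \<omega> / real n" using elim by linarith
          then show "?u \<le> Mx n \<omega>" using elim \<kappa> by (simp add: field_simps)
        qed
      qed measurable
      also have "\<dots> \<le> 4 * exp (- ?u\<^sup>2 / (4 * real n * \<sigma>\<^sup>2))"
        using elim t \<kappa> by (intro Mx_tail) auto
      also have "- ?u\<^sup>2 / (4 * real n * \<sigma>\<^sup>2) = - (1 / (16 * \<kappa>\<^sup>2)) * t\<^sup>2 * real n / \<sigma>\<^sup>2"
        using elim \<kappa> \<sigma> by (simp add: field_simps power2_eq_square)
      finally show ?case .
    qed
  qed
  have conv: "AE \<omega> in M. (\<lambda>n. R n \<omega>) \<longlonglongrightarrow> 0"
  proof -
    have ev: "AE \<omega> in M. \<forall>\<^sub>F n in sequentially. \<bar>R n \<omega>\<bar> < t" if t: "0 < t" for t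
    proof -
      define D where "D n = {\<omega> \<in> space M. t \<le> \<bar>R (Suc n) \<omega>\<bar>}" for n
      define q where "q = exp (- (1 / (16 * \<kappa>\<^sup>2)) * t\<^sup>2 / \<sigma>\<^sup>2)"
      have q: "0 \<le> q" "q < 1" using t \<sigma> \<kappa> by (auto simp: q_def)
      have D_sets: "D n \<in> events" for n unfolding D_def by measurable
      have summ: "summable (\<lambda>n. prob (D n))"
      proof (rule summable_comparison_test_ev)
        show "summable (\<lambda>n. 4 * q ^ Suc n)"
          using q by (intro summable_mult) (simp add: summable_geometric)
        have "\<forall>\<^sub>F n in sequentially. prob (D n) \<le> 4 * exp (- (1 / (16 * \<kappa>\<^sup>2)) * t\<^sup>2 * real (Suc n) / \<sigma>\<^sup>2)"
          unfolding D_def using tail[OF t] by (subst eventually_sequentially_Suc)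
        moreover have "q ^ Suc n = exp (- (1 / (16 * \<kappa>\<^sup>2)) * t\<^sup>2 * real (Suc n) / \<sigma>\<^sup>2)" for n
          unfolding q_def by (simp only: exp_of_nat_mult[symmetric]) (simp add: field_simps)
        ultimately show "\<forall>\<^sub>F n in sequentially. norm (prob (D n)) \<le> 4 * q ^ Suc n"
          by simp
      qed
      have "AE \<omega> in M. \<forall>\<^sub>F n in sequentially. \<omega> \<in> space M - D n"
        by (rule borel_cantelli_AE1[OF D_sets _ summ]) (simp add: emeasure_eq_measure)
      then show ?thesis
      proof (eventually_elim)
        case (elim \<omega>)
        then have "\<forall>\<^sub>F n in sequentially. \<bar>R (Suc n) \<omega>\<bar> < t"
          by eventually_elim (auto simp: D_def)
        then show ?case by (subst (asm) eventually_sequentially_Suc)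
      qed
    qed
    have "AE \<omega> in M. \<forall>i. \<forall>\<^sub>F n in sequentially. \<bar>R n \<omega>\<bar> < 1 / real (Suc i)"
      by (subst AE_all_countable) (auto intro: ev)
    then show ?thesis
    proof eventually_elim
      case (elim \<omega>)
      show ?case
      proof (rule tendstoI)
        fix e :: real assume "0 < e"
        then obtain i where "1 / real (Suc i) < e" using nat_approx_posE by blast
        with elim[rule_format, of i] show "\<forall>\<^sub>F n in sequentially. dist (R n \<omega>) 0 < e"
          by (auto elim!: eventually_mono)
      qed
    qed
  qed
  have mean: "\<forall>\<^sub>F n in sequentially. integrable M (\<lambda>\<omega>. \<bar>R n \<omega>\<bar>) \<and>
      expectation (\<lambda>\<omega>. \<bar>R n \<omega>\<bar>) \<le> (16 * \<kappa> + 1) * (\<sigma> / sqrt (real n))"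
  proof -
    have "(\<lambda>n. E / sqrt (real n)) \<longlonglongrightarrow> 0"
      by (intro tendsto_divide_0[OF tendsto_const] filterlim_at_top_imp_at_infinity
          filterlim_compose[OF sqrt_at_top filterlim_real_sequentially])
    then have "\<forall>\<^sub>F n in sequentially. E / sqrt (real n) < \<sigma>" using \<sigma> by (rule order_tendstoD)
    with large show ?thesis
    proof eventually_elim
      case (elim n)
      \<comment> \<open>With this mesh the tail at \<open>i * w\<close> is at most \<open>4 * exp (- i\<^sup>2)\<close>, hence at most \<open>4 * (1 / 2) ^ i\<close>.\<close>
      define w where "w = 2 * \<sigma> * sqrt (real n)"
      have w: "0 < w" using \<sigma> elim by (simp add: w_def)
      have tl: "prob {\<omega> \<in> space M. real i * w \<le> Mx n \<omega>} \<le> 4 * (1 / 2) ^ i" for i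
      proof -
        have "prob {\<omega> \<in> space M. real i * w \<le> Mx n \<omega>} \<le> 4 * exp (- (real i * w)\<^sup>2 / (4 * real n * \<sigma>\<^sup>2))"
          using elim w by (intro Mx_tail) auto
        also have "- (real i * w)\<^sup>2 / (4 * real n * \<sigma>\<^sup>2) = - (real i)\<^sup>2"
          using elim \<sigma> by (simp add: w_def power_mult_distrib field_simps)
        also have "exp (- (real i)\<^sup>2) \<le> exp (real i * (- 1))"
          by (cases i) (auto simp: power2_eq_square algebra_simps)
        also have "\<dots> = exp (- 1) ^ i" by (rule exp_of_nat_mult)
        also have "\<dots> \<le> (1 / 2) ^ i"
          using exp_ge_add_one_self[of 1] by (intro power_mono) (auto simp: exp_minus field_simps)
        finally show ?thesis by simp
      qed
      note Mx_int = expectation_le_of_geometric_tail[OF Mx_meas Mx_nn w tl]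
      have bnd: "\<bar>R n \<omega>\<bar> \<le> (\<kappa> * Mx n \<omega> + E) / real n" for \<omega>
        using R_Mx elim by simp
      have int_b: "integrable M (\<lambda>\<omega>. (\<kappa> * Mx n \<omega> + E) / real n)"
        using Mx_int(1) by simp
      have int: "integrable M (\<lambda>\<omega>. \<bar>R n \<omega>\<bar>)"
      proof (rule Bochner_Integration.integrable_bound[OF int_b])
        have "norm \<bar>R n \<omega>\<bar> \<le> norm ((\<kappa> * Mx n \<omega> + E) / real n)" for \<omega>
          using order_trans[OF bnd abs_ge_self] by (simp only: real_norm_def abs_idempotent)
        then show "AE \<omega> in M. norm \<bar>R n \<omega>\<bar> \<le> norm ((\<kappa> * Mx n \<omega> + E) / real n)" by simp
      qed measurable
      have "expectation (\<lambda>\<omega>. \<bar>R n \<omega>\<bar>) \<le> expectation (\<lambda>\<omega>. (\<kappa> * Mx n \<omega> + E) / real n)"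
        using bnd by (intro integral_mono[OF int int_b])
      also have "\<dots> = (\<kappa> * expectation (Mx n) + E) / real n"
        using Mx_int(1) by (simp add: prob_space)
      also have "\<dots> \<le> (\<kappa> * (2 * 4 * w) + \<sigma> * sqrt (real n)) / real n"
        using Mx_int(2) \<kappa> elim by (intro divide_right_mono add_mono mult_left_mono) (auto simp: field_simps)
      also have "\<dots> = (16 * \<kappa> + 1) * \<sigma> * (sqrt (real n) / real n)" by (simp add: w_def field_simps)
      also have "sqrt (real n) / real n = 1 / sqrt (real n)"
        using elim by (simp add: field_simps)
      finally show ?case using int by simp
    qed
  qed
  from conv have "AE \<omega> in M. (\<lambda>n. X n \<omega>) \<longlonglongrightarrow> x"
    by eventually_elim (auto simp: R_def intro: LIM_zero_cancel)
  with tail mean show ?thesis by (simp add: R_def)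
qed

section \<open>Minkowski inequality for the addition of a constant\<close>

lemma finite_measure_lebesgue_on_Icc: "finite_measure (lebesgue_on {a..b::real})"
  by (rule finite_measureI) (auto simp: emeasure_restrict_space emeasure_lborel_Icc_eq)

lemma integrable_lebesgue_on_bounded:
  fixes f :: "real \<Rightarrow> real"
  assumes "f \<in> borel_measurable (lebesgue_on {a..b})" and "\<And>x. x \<in> {a..b} \<Longrightarrow> \<bar>f x\<bar> \<le> H"
  shows "integrable (lebesgue_on {a..b}) f"
  using assms
  by (intro finite_measure.integrable_const_bound[OF finite_measure_lebesgue_on_Icc, where B = H])
    (auto intro!: AE_I2)

text \<open>Convexity of \<open>x powr q\<close> at the point \<open>(x + e) / (N + E)\<close>, read as the average of \<open>x / N\<close> and \<open>e / E\<close>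
  with weights \<open>N / (N + E)\<close> and \<open>E / (N + E)\<close>. If \<open>N\<close> and \<open>E\<close> are taken to be the \<open>L\<^sup>q\<close> norms of \<open>x\<close> and
  of the constant \<open>e\<close>, integration turns the bracket into \<open>1\<close>, which is Minkowski's inequality.\<close>

lemma powr_add_le_convex:
  fixes q x e N E :: real
  assumes q: "1 \<le> q" and x: "0 \<le> x" and e: "0 < e" and N: "0 < N" and E: "0 < E"
  shows "(x + e) powr q \<le> (N + E) powr q * (N / (N + E) * (x powr q / N powr q) + E / (N + E) * (e powr q / E powr q))"
proof -
  have "((x + e) / (N + E)) powr q \<le> N / (N + E) * (x / N) powr q + E / (N + E) * (e / E) powr q"
  proof (cases "x = 0")
    case True
    \<comment> \<open>Convexity is used on the open half-line only; at \<open>x = 0\<close> the weight satisfies \<open>u powr q \<le> u\<close> directly.\<close>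
    have "(E / (N + E)) powr q \<le> (E / (N + E)) powr 1"
      using q N E by (intro powr_mono') auto
    then have "(E / (N + E)) powr q * (e / E) powr q \<le> E / (N + E) * (e / E) powr q"
      using N E by (intro mult_right_mono) auto
    moreover have "(E / (N + E)) powr q * (e / E) powr q = (e / (N + E)) powr q"
      using N E e powr_mult[of "E / (N + E)" "e / E" q] by simp
    ultimately show ?thesis using True by simp
  next
    case False
    have "(N / (N + E)) *\<^sub>R (x / N) + (E / (N + E)) *\<^sub>R (e / E) = (x + e) / (N + E)"
      using N E by (simp add: add_divide_distrib)
    moreover have "N / (N + E) + E / (N + E) = 1"
      using N E by (simp flip: add_divide_distrib)
    moreover have "\<And>u v x y. \<lbrakk>0 < x; 0 < y; 0 \<le> u; 0 \<le> v; u + v = 1\<rbrakk>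
        \<Longrightarrow> (u *\<^sub>R x + v *\<^sub>R y) powr q \<le> u * x powr q + v * y powr q"
      using powr_convex[OF q] unfolding convex_on_def by blast
    from this[of "x / N" "e / E" "N / (N + E)" "E / (N + E)"]
    have "N / (N + E) + E / (N + E) = 1 \<Longrightarrow>
        ((N / (N + E)) *\<^sub>R (x / N) + (E / (N + E)) *\<^sub>R (e / E)) powr q
          \<le> N / (N + E) * (x / N) powr q + E / (N + E) * (e / E) powr q"
      using False x e N E by simp
    ultimately show ?thesis by simp
  qed
  then have "(N + E) powr q * ((x + e) / (N + E)) powr q
      \<le> (N + E) powr q * (N / (N + E) * (x / N) powr q + E / (N + E) * (e / E) powr q)"
    by (rule mult_left_mono) simp
  moreover have "(N + E) powr q * ((x + e) / (N + E)) powr q = (x + e) powr q"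
    using N E x e powr_mult[of "N + E" "(x + e) / (N + E)" q] by simp
  ultimately show ?thesis using x e N E by (simp add: powr_divide)
qed

text \<open>Minkowski's inequality against a constant, with a factor \<open>max 1 (b - a)\<close> that dominates
  \<open>(b - a) powr (1 / p)\<close> for all \<open>p\<close> at once. This is why the final constants do not depend on \<open>p\<close>.\<close>

lemma Lp_norm_le_add_const:
  assumes ab: "a < b" and p: "1 \<le> p"
    and g[measurable]: "g \<in> borel_measurable (lebesgue_on {a..b})"
    and h[measurable]: "h \<in> borel_measurable (lebesgue_on {a..b})"
    and H: "\<And>x. x \<in> {a..b} \<Longrightarrow> \<bar>h x\<bar> \<le> H"
    and gh: "\<And>x. x \<in> {a..b} \<Longrightarrow> \<bar>g x\<bar> \<le> \<bar>h x\<bar> + e"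
    and e: "0 \<le> e"
  shows "Lp_norm a b p g \<le> Lp_norm a b p h + max 1 (b - a) * e"
proof (cases "p = \<infinity>")
  case True
  let ?M = "lebesgue_on {a..b}"
  let ?es = "\<lambda>f :: real \<Rightarrow> real. esssup ?M (\<lambda>x. ereal \<bar>f x\<bar>)"
  have ne: "emeasure ?M (space ?M) \<noteq> 0" using ab by (simp add: emeasure_restrict_space)
  have nonneg: "0 \<le> ?es f" if "f \<in> borel_measurable ?M" for f
  proof -
    have "0 = esssup ?M (\<lambda>x. 0 :: ereal)" using esssup_const[OF ne, of "0::ereal"] by simp
    also have "\<dots> \<le> ?es f" by (intro esssup_mono) auto
    finally show ?thesis .
  qed
  have "?es h \<le> ereal H" using H by (intro esssup_I AE_I2) auto
  then obtain r where r: "?es h = ereal r" using nonneg[OF h] by (cases "?es h") auto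
  have "AE x in ?M. ereal \<bar>h x\<bar> \<le> ereal r" unfolding r[symmetric] by (rule esssup_AE)
  then have "AE x in ?M. ereal \<bar>g x\<bar> \<le> ereal (r + e)"
  proof (rule AE_mp, intro AE_I2 impI)
    fix x assume "x \<in> space ?M" "ereal \<bar>h x\<bar> \<le> ereal r"
    then show "ereal \<bar>g x\<bar> \<le> ereal (r + e)" using gh[of x] by simp
  qed
  then have "?es g \<le> ereal (r + e)" by (intro esssup_I) auto
  then have "real_of_ereal (?es g) \<le> r + e" using nonneg[OF g] by (cases "?es g") auto
  moreover have "1 * e \<le> max 1 (b - a) * e" using e by (intro mult_right_mono) auto
  ultimately show ?thesis using True r by (simp add: Lp_norm_def)
next
  case False
  define q where "q = enn2real p"
  have q: "1 \<le> q"
    using p False enn2real_mono[of 1 p] by (simp add: q_def less_top)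
  let ?M = "lebesgue_on {a..b}"
  define Ig where "Ig = (LINT x|?M. \<bar>g x\<bar> powr q)"
  define Ih where "Ih = (LINT x|?M. \<bar>h x\<bar> powr q)"
  define c where "c = (b - a) powr (1 / q)"
  have c: "0 < c" "c \<le> max 1 (b - a)"
  proof -
    show "0 < c" using ab by (simp add: c_def)
    show "c \<le> max 1 (b - a)"
    proof (cases "1 \<le> b - a")
      case True
      then have "c \<le> (b - a) powr 1" unfolding c_def using q by (intro powr_mono) auto
      then show ?thesis using True by simp
    next
      case False
      then have "c \<le> 1" unfolding c_def using q ab by (intro powr_le1) auto
      then show ?thesis by simp
    qed
  qed
  have int_h: "integrable ?M (\<lambda>x. \<bar>h x\<bar> powr q)"
    using H q by (intro integrable_lebesgue_on_bounded[where H = "H powr q"]) (auto intro!: powr_mono2)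
  have int_g: "integrable ?M (\<lambda>x. \<bar>g x\<bar> powr q)"
    using H gh q
    by (intro integrable_lebesgue_on_bounded[where H = "(H + e) powr q"])
       (auto intro!: powr_mono2 order_trans[OF gh])
  have Ih: "0 \<le> Ih" "0 \<le> Ig" by (simp_all add: Ih_def Ig_def)
  have "Ig powr (1 / q) \<le> Ih powr (1 / q) + c * e"
  proof (rule field_le_epsilon)
    fix \<delta> :: real assume \<delta>: "0 < \<delta>"
    \<comment> \<open>Both norms are enlarged a little, so that the divisions by \<open>N\<close> and \<open>E\<close> below are legitimate.\<close>
    define N where "N = Ih powr (1 / q) + \<delta> / 2"
    define e' where "e' = e + \<delta> / (2 * c)"
    define E where "E = c * e'"
    have pos: "0 < N" "0 < e'" "0 < E"
    proof -
      show "0 < N" using \<delta> by (auto simp: N_def intro!: add_nonneg_pos)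
      show "0 < e'" using \<delta> c e by (auto simp: e'_def intro!: add_nonneg_pos)
      then show "0 < E" using c by (simp add: E_def)
    qed
    have N: "Ih \<le> N powr q"
    proof -
      have "Ih = (Ih powr (1 / q)) powr q" using Ih q by (simp add: powr_powr)
      also have "\<dots> \<le> N powr q" using \<delta> q by (intro powr_mono2) (auto simp: N_def)
      finally show ?thesis .
    qed
    have cq: "c powr q = b - a" using ab q by (simp add: c_def powr_powr)
    have Eq: "(b - a) * (e' powr q / E powr q) = 1"
      using pos c ab by (simp add: E_def powr_mult cq)
    let ?u = "\<lambda>x. (N + E) powr q * (N / (N + E) * (\<bar>h x\<bar> powr q / N powr q) + E / (N + E) * (e' powr q / E powr q))"
    have "Ig \<le> (LINT x|?M. ?u x)"
      unfolding Ig_def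
    proof (rule integral_mono[OF int_g])
      show "integrable ?M ?u"
        using int_h finite_measure.integrable_const[OF finite_measure_lebesgue_on_Icc] by simp
      fix x assume "x \<in> space ?M"
      then have x: "x \<in> {a..b}" by simp
      have "\<bar>g x\<bar> powr q \<le> (\<bar>h x\<bar> + e') powr q"
        using gh[OF x] q \<delta> c by (intro powr_mono2) (auto simp: e'_def intro: order_trans)
      also have "\<dots> \<le> ?u x" using q pos by (intro powr_add_le_convex) auto
      finally show "\<bar>g x\<bar> powr q \<le> ?u x" .
    qed
    also have "(LINT x|?M. ?u x) = (N + E) powr q * (N / (N + E) * (Ih / N powr q) + E / (N + E) * ((b - a) * (e' powr q / E powr q)))"
      using int_h finite_measure.integrable_const[OF finite_measure_lebesgue_on_Icc] ab
      by (simp add: Ih_def measure_restrict_space)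
    also have "\<dots> = (N + E) powr q * (N / (N + E) * (Ih / N powr q) + E / (N + E) * 1)"
      by (simp only: Eq)
    also have "\<dots> \<le> (N + E) powr q * (N / (N + E) * 1 + E / (N + E) * 1)"
      using N pos by (intro mult_left_mono add_mono) auto
    also have "\<dots> = (N + E) powr q" using pos by (simp flip: add_divide_distrib)
    finally have "Ig powr (1 / q) \<le> ((N + E) powr q) powr (1 / q)"
      using Ih q by (intro powr_mono2) auto
    also have "\<dots> = N + E" using pos q by (simp add: powr_powr)
    also have "\<dots> = Ih powr (1 / q) + c * e + \<delta>" using c by (simp add: N_def E_def e'_def field_simps)
    finally show "Ig powr (1 / q) \<le> Ih powr (1 / q) + c * e + \<delta>" .
  qed
  also have "c * e \<le> max 1 (b - a) * e" using c e by (intro mult_right_mono) auto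
  finally show ?thesis using False by (simp add: Lp_norm_def Ig_def Ih_def q_def)
qed

section \<open>Vectors as step functions on the grid\<close>

text \<open>On \<open>[a,b]\<close>, the step function that takes the value \<open>v k\<close> at the points closer to the \<open>k\<close>-th node than to any
  other node; the two end cells have half the width of the others, exactly as in the trapezoid weights.\<close>

definition nearest_node_step :: "real \<Rightarrow> real \<Rightarrow> nat \<Rightarrow> (nat \<Rightarrow> real) \<Rightarrow> real \<Rightarrow> real" where
  "nearest_node_step a b n v x = v (nat \<lfloor>(x - a) * real n / (b - a) + 1 / 2\<rfloor>)"

abbreviation grid_node :: "real \<Rightarrow> real \<Rightarrow> nat \<Rightarrow> nat \<Rightarrow> real" where
  "grid_node a b n k \<equiv> a + real k / real n * (b - a)"

lemma nearest_node_step_eq: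
  assumes "a < b" "1 \<le> n" "grid_node a b n k - (b - a) / (2 * real n) \<le> x" "x < grid_node a b n k + (b - a) / (2 * real n)"
  shows "nearest_node_step a b n v x = v k"
proof -
  define d where "d = (b - a) / real n"
  have d: "0 < d" using assms by (simp add: d_def)
  have y: "(x - a) * real n / (b - a) = (x - a) / d" by (simp add: d_def)
  have "(real k - 1 / 2) * d \<le> x - a" "x - a < (real k + 1 / 2) * d"
    using assms(3,4) by (simp_all add: d_def algebra_simps)
  then have "real k - 1 / 2 \<le> (x - a) / d" "(x - a) / d < real k + 1 / 2"
    using d by (simp_all add: pos_le_divide_eq pos_divide_less_eq)
  then have "real k \<le> (x - a) * real n / (b - a) + 1 / 2" "(x - a) * real n / (b - a) + 1 / 2 < real k + 1"
    unfolding y by simp_all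
  then have "\<lfloor>(x - a) * real n / (b - a) + 1 / 2\<rfloor> = int k" by (simp add: floor_eq_iff)
  then show ?thesis by (simp add: nearest_node_step_def)
qed

lemma nearest_node_exists:
  assumes ab: "a < b" and n: "1 \<le> n" and x: "x \<in> {a..b}"
  obtains k where "k \<le> n" "\<And>v. nearest_node_step a b n v x = v k" "\<bar>grid_node a b n k - x\<bar> \<le> (b - a) / real n"
    "grid_node a b n k \<in> {a..b}"
proof -
  define y where "y = (x - a) * real n / (b - a)"
  define k where "k = nat \<lfloor>y + 1 / 2\<rfloor>"
  have y: "0 \<le> y" "y \<le> real n" using assms by (auto simp: y_def field_simps)
  have k: "real k \<le> y + 1 / 2" "y + 1 / 2 < real k + 1"
    using y unfolding k_def by linarith+
  then have kn: "k \<le> n" using y by linarith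
  have eq: "x = a + y / real n * (b - a)" using assms by (simp add: y_def)
  have "grid_node a b n k - x = (real k - y) / real n * (b - a)" by (simp add: eq algebra_simps diff_divide_distrib)
  moreover have "\<bar>(real k - y) / real n * (b - a)\<bar> \<le> 1 / real n * (b - a)"
  proof -
    have "\<bar>real k - y\<bar> \<le> 1" using k by linarith
    then have "\<bar>real k - y\<bar> / real n \<le> 1 / real n" by (rule divide_right_mono) simp
    from mult_right_mono[OF this, of "b - a"] show ?thesis using ab by (simp add: abs_mult)
  qed
  ultimately have "\<bar>grid_node a b n k - x\<bar> \<le> (b - a) / real n" by simp
  moreover have "grid_node a b n k \<in> {a..b}"
  proof -
    have "real k / real n * (b - a) \<le> 1 * (b - a)" using ab kn n by (intro mult_right_mono) auto
    then show ?thesis using ab by auto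
  qed
  ultimately show ?thesis
    using that[of k] kn by (auto simp: nearest_node_step_def k_def y_def)
qed

lemma grid_node_in:
  assumes "a < b" "1 \<le> n" "k \<le> n"
  shows "grid_node a b n k \<in> {a..b}"
proof -
  have "real k / real n * (b - a) \<le> 1 * (b - a)" using assms by (intro mult_right_mono) auto
  then show ?thesis using assms by auto
qed

lemma measurable_nearest_node_step[measurable]: "nearest_node_step a b n v \<in> borel_measurable borel"
  unfolding nearest_node_step_def by measurable

text \<open>Each grid cell is halved by the step function between its two end values, so the trapezoid sum is
  the integral of the step function.\<close>

lemma has_integral_nearest_node_step:
  assumes ab: "a < b" and n: "1 \<le> n"
  shows "(nearest_node_step a b n v has_integral dvolterra a b n v k) {a..grid_node a b n k}"
proof (induction k)
  case 0
  then show ?case by (simp add: dvolterra_def has_integral_refl)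
next
  case (Suc k)
  let ?h = "(b - a) / (2 * real n)"
  let ?x = "grid_node a b n k"
  have h: "0 < ?h" using ab n by simp
  have nx: "grid_node a b n (Suc k) = ?x + ?h + ?h" using n by (simp add: field_simps)
  have x: "a \<le> ?x" using ab by simp
  have "((\<lambda>_. v k) has_integral ?h * v k) {?x..?x + ?h}"
    using has_integral_const_real[of "v k" ?x "?x + ?h"] h by simp
  moreover have "nearest_node_step a b n v x = v k" if "x \<in> box ?x (?x + ?h)" for x
    using that h unfolding box_real greaterThanLessThan_iff
    by (intro nearest_node_step_eq[OF ab n]; linarith)
  ultimately have 1: "(nearest_node_step a b n v has_integral ?h * v k) {?x..?x + ?h}"
    unfolding cbox_interval[symmetric] by (rule has_integral_spike_interior)
  have "((\<lambda>_. v (Suc k)) has_integral ?h * v (Suc k)) {?x + ?h..grid_node a b n (Suc k)}"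
    using has_integral_const_real[of "v (Suc k)" "?x + ?h" "grid_node a b n (Suc k)"] h nx by simp
  moreover have "nearest_node_step a b n v x = v (Suc k)" if "x \<in> box (?x + ?h) (grid_node a b n (Suc k))" for x
    using that h nx unfolding box_real greaterThanLessThan_iff
    by (intro nearest_node_step_eq[OF ab n]; linarith)
  ultimately have 2: "(nearest_node_step a b n v has_integral ?h * v (Suc k)) {?x + ?h..grid_node a b n (Suc k)}"
    unfolding cbox_interval[symmetric] by (rule has_integral_spike_interior)
  have "(nearest_node_step a b n v has_integral dvolterra a b n v k + ?h * v k + ?h * v (Suc k)) {a..grid_node a b n (Suc k)}"
    using h nx x
    by (intro has_integral_combine[OF _ _ has_integral_combine[OF _ _ Suc 1] 2]) auto
  also have "dvolterra a b n v k + ?h * v k + ?h * v (Suc k) = dvolterra a b n v (Suc k)"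
    by (simp add: dvolterra_def algebra_simps)
  finally show ?case .
qed

text \<open>The absolute \<open>q\<close>-th power of the step function of \<open>v\<close> is the step function of the \<open>q\<close>-th powers, so
  the trapezoid identity gives finite exponents. For \<open>p = \<infinity>\<close> every value \<open>v k\<close> is attained on an
  interval of positive length, so the essential supremum sees it.\<close>

lemma tau_norm_eq_Lp_norm_step:
  assumes ab: "a < b" and n: "1 \<le> n"
  shows "tau_norm a b n p v = Lp_norm a b p (nearest_node_step a b n v)"
proof (cases "p = \<infinity>")
  case True
  let ?M = "lebesgue_on {a..b}"
  let ?g = "\<lambda>x. ereal \<bar>nearest_node_step a b n v x\<bar>"
  have [measurable]: "nearest_node_step a b n v \<in> borel_measurable ?M"
    by (intro measurable_restrict_space1 measurable_completion) simp
  define m where "m = Max ((\<lambda>k. \<bar>v k\<bar>) ` {0..n})"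
  have "esssup ?M ?g \<le> ereal m"
  proof (intro esssup_I AE_I2)
    fix x assume "x \<in> space ?M"
    then have "x \<in> {a..b}" by simp
    then obtain k where "k \<le> n" "nearest_node_step a b n v x = v k"
      using nearest_node_exists[OF ab n] by metis
    then show "?g x \<le> ereal m" by (auto simp: m_def intro!: Max_ge)
  qed measurable
  moreover have "ereal m \<le> esssup ?M ?g"
  proof -
    have "m \<in> (\<lambda>k. \<bar>v k\<bar>) ` {0..n}" unfolding m_def by (intro Max_in) auto
    then obtain k where k: "k \<le> n" "m = \<bar>v k\<bar>" by auto
    define d where "d = (b - a) / (2 * real n)"
    have d: "0 < d" using ab n by (simp add: d_def)
    \<comment> \<open>An interval of length \<open>d\<close> inside the cell of the \<open>k\<close>-th node: it lies to the right of the node,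
      except at the last node, where only the left half of the cell is in \<open>[a,b]\<close>.\<close>
    define l where "l = (if k = n then b - d else grid_node a b n k)"
    have l: "a \<le> l" "l + d \<le> b" "grid_node a b n k - d \<le> l" "l + d \<le> grid_node a b n k + d"
    proof -
      have db: "2 * real n * d = b - a" using n by (simp add: d_def)
      have gk: "grid_node a b n k = a + real k * (2 * d)"
      proof -
        have "2 * d = (b - a) / real n" using n by (simp add: d_def field_simps)
        then show ?thesis by simp
      qed
      have "1 * d \<le> 2 * real n * d" using n d by (intro mult_right_mono) auto
      then have "d \<le> b - a" using db by simp
      moreover have "real k * (2 * d) + 2 * d \<le> b - a" if "k \<noteq> n"
      proof -
        have "(real k + 1) * (2 * d) \<le> real n * (2 * d)" using that k d by (intro mult_right_mono) auto
        then show ?thesis using db by (simp add: algebra_simps)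
      qed
      moreover have "0 \<le> real k * (2 * d)" using d by simp
      moreover have "real k * (2 * d) = b - a" if "k = n" using db that by (simp add: mult.commute mult.left_commute)
      ultimately show "a \<le> l" "l + d \<le> b" "grid_node a b n k - d \<le> l" "l + d \<le> grid_node a b n k + d"
        using d unfolding l_def gk by (cases "k = n"; simp)+
    qed
    have stp: "nearest_node_step a b n v x = v k" if "x \<in> {l<..<l + d}" for x
      using that l unfolding d_def by (intro nearest_node_step_eq[OF ab n]) auto
    have "emeasure ?M {l<..<l + d} = ennreal d"
      using l d by (subst emeasure_restrict_space) auto
    then have nz: "emeasure ?M {l<..<l + d} \<noteq> 0" using d by simp
    show ?thesis
    proof (rule ccontr)
      assume "\<not> ereal m \<le> esssup ?M ?g"
      have ls: "{l<..<l + d} \<in> sets ?M" using l by (subst sets_restrict_space_iff) auto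
      have "AE x in ?M. x \<notin> {l<..<l + d}"
        using esssup_AE[of ?g ?M]
      proof (rule AE_mp, intro AE_I2 impI notI)
        fix x assume "?g x \<le> esssup ?M ?g" "x \<in> {l<..<l + d}"
        with stp[of x] k \<open>\<not> ereal m \<le> esssup ?M ?g\<close> show False by simp
      qed
      then have "{l<..<l + d} \<in> null_sets ?M" using ls by (simp add: AE_iff_null_sets)
      with nz show False by (simp add: null_sets_def)
    qed
  qed
  ultimately have "esssup ?M ?g = ereal m" by (rule antisym)
  then show ?thesis using True by (simp add: tau_norm_def Lp_norm_def m_def)
next
  case False
  define q where "q = enn2real p"
  let ?M = "lebesgue_on {a..b}"
  define w where "w k = \<bar>v k\<bar> powr q" for k
  have meas: "nearest_node_step a b n w \<in> borel_measurable ?M"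
    by (intro measurable_restrict_space1 measurable_completion) simp
  have bd: "\<bar>nearest_node_step a b n w x\<bar> \<le> (\<Sum>k\<le>n. w k)" if x: "x \<in> {a..b}" for x
  proof -
    obtain k where "k \<le> n" "nearest_node_step a b n w x = w k"
      using nearest_node_exists[OF ab n x] by metis
    moreover have "w k \<le> (\<Sum>k\<le>n. w k)" using \<open>k \<le> n\<close> by (intro member_le_sum) (auto simp: w_def)
    ultimately show ?thesis by (simp add: w_def)
  qed
  have "(LINT x|?M. \<bar>nearest_node_step a b n v x\<bar> powr q) = (LINT x|?M. nearest_node_step a b n w x)"
    by (simp add: nearest_node_step_def w_def)
  also have "\<dots> = integral {a..b} (nearest_node_step a b n w)"
    by (intro lebesgue_integral_eq_integral integrable_lebesgue_on_bounded[OF meas bd]) auto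
  also have "\<dots> = dvolterra a b n w n"
    using has_integral_nearest_node_step[OF ab n, of w n] n by (intro integral_unique) simp
  finally show ?thesis using False by (simp add: tau_norm_def Lp_norm_def dvolterra_def w_def q_def)
qed

text \<open>The step function of \<open>v\<close> is uniformly close to \<open>F\<close>: on a cell \<open>F\<close> varies by at most \<open>\<Lambda>\<close> times the
  mesh. Since both discrete and continuous norms are \<open>L\<^sup>p\<close> norms on \<open>[a,b]\<close>, Minkowski's inequality
  compares them at a rate \<open>1 / n\<close> that is uniform in \<open>p\<close>.\<close>

lemma tau_norm_Lp_norm_close:
  assumes ab: "a < b" and n: "1 \<le> n" and p: "1 \<le> p"
    and F: "\<Lambda>-lipschitz_on {a..b} F"
    and v: "\<And>k. k \<le> n \<Longrightarrow> \<bar>v k - F (grid_node a b n k)\<bar> \<le> \<delta>"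
  shows "\<bar>tau_norm a b n p v - Lp_norm a b p F\<bar> \<le> max 1 (b - a) * (\<delta> + \<Lambda> * (b - a) / real n)"
proof -
  let ?e = "\<delta> + \<Lambda> * (b - a) / real n" and ?G = "nearest_node_step a b n v"
  have L: "0 \<le> \<Lambda>" using F by (rule lipschitz_on_nonneg)
  have \<delta>: "0 \<le> \<delta>" using v[of 0] by (meson abs_ge_zero le0 order_trans)
  have e: "0 \<le> ?e" using L \<delta> ab by simp
  have dist: "\<bar>F x - F y\<bar> \<le> \<Lambda> * \<bar>x - y\<bar>" if "x \<in> {a..b}" "y \<in> {a..b}" for x y
    using lipschitz_onD[OF F that] by (simp add: dist_real_def)
  have close: "\<bar>?G x - F x\<bar> \<le> ?e" if x: "x \<in> {a..b}" for x
  proof -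
    obtain k where k: "k \<le> n" "?G x = v k" "\<bar>grid_node a b n k - x\<bar> \<le> (b - a) / real n"
      "grid_node a b n k \<in> {a..b}" using nearest_node_exists[OF ab n x] by metis
    have "\<bar>F (grid_node a b n k) - F x\<bar> \<le> \<Lambda> * \<bar>grid_node a b n k - x\<bar>" using dist[OF k(4) x] .
    also have "\<dots> \<le> \<Lambda> * ((b - a) / real n)" using k(3) L by (rule mult_left_mono)
    finally show ?thesis using v[OF k(1)] k(2) by simp
  qed
  have mG: "?G \<in> borel_measurable (lebesgue_on {a..b})"
    by (intro measurable_restrict_space1 measurable_completion) simp
  have mF: "F \<in> borel_measurable (lebesgue_on {a..b})"
    using lipschitz_on_continuous_on[OF F] by (intro continuous_imp_measurable_on_sets_lebesgue) auto
  have bF: "\<bar>F x\<bar> \<le> \<bar>F a\<bar> + \<Lambda> * (b - a)" if "x \<in> {a..b}" for x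
  proof -
    have "\<Lambda> * \<bar>x - a\<bar> \<le> \<Lambda> * (b - a)" using that L by (intro mult_left_mono) auto
    then show ?thesis using dist[OF that, of a] ab by simp
  qed
  have bG: "\<bar>?G x\<bar> \<le> \<bar>F a\<bar> + \<Lambda> * (b - a) + ?e" if "x \<in> {a..b}" for x
    using bF[OF that] close[OF that] by linarith
  have "Lp_norm a b p ?G \<le> Lp_norm a b p F + max 1 (b - a) * ?e"
    using close by (intro Lp_norm_le_add_const[OF ab p mG mF bF _ e]) (smt (verit))+
  moreover have "Lp_norm a b p F \<le> Lp_norm a b p ?G + max 1 (b - a) * ?e"
    using close by (intro Lp_norm_le_add_const[OF ab p mF mG bG _ e]) (smt (verit))+
  ultimately show ?thesis unfolding tau_norm_eq_Lp_norm_step[OF ab n] by linarith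
qed

section \<open>Piecewise Lipschitz functions\<close>

lemma partition_cases:
  fixes c :: "nat \<Rightarrow> real"
  assumes "x \<in> {c 0..c r}"
  shows "(\<exists>i\<le>r. x = c i) \<or> (\<exists>j<r. x \<in> {c j<..<c (Suc j)})"
  using assms
proof (induction r)
  case (Suc r)
  show ?case
  proof (cases "x \<le> c r")
    case True
    then show ?thesis using Suc by (auto simp: less_Suc_eq le_Suc_eq)
  next
    case False
    then have "x = c (Suc r) \<or> x \<in> {c r<..<c (Suc r)}" using Suc.prems by auto
    then show ?thesis by blast
  qed
qed auto

lemma partition_mono:
  fixes c :: "nat \<Rightarrow> real"
  assumes "\<forall>j<r. c j < c (Suc j)" "i \<le> j" "j \<le> r"
  shows "c i \<le> c j"
  using assms(2,3) assms(1)
proof (induction j rule: dec_induct)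
  case (step j)
  then show ?case by (meson Suc_le_lessD less_imp_le order_trans)
qed auto

lemma piecewise_lipschitz_bounded:
  fixes f :: "real \<Rightarrow> real" and c :: "nat \<Rightarrow> real"
  assumes lip: "\<forall>j<r. L-lipschitz_on {c j<..<c (Suc j)} f"
  obtains Mf where "0 \<le> Mf" "\<And>x. x \<in> {c 0..c r} \<Longrightarrow> \<bar>f x\<bar> \<le> Mf"
proof
  define mid where "mid j = (c j + c (Suc j)) / 2" for j
  let ?A = "\<Sum>i\<le>r. \<bar>f (c i)\<bar>" and ?t = "\<lambda>j. \<bar>f (mid j)\<bar> + \<bar>L\<bar> * \<bar>c (Suc j) - c j\<bar>"
  have A: "0 \<le> ?A" and B: "0 \<le> (\<Sum>j<r. ?t j)" by (auto intro!: sum_nonneg)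
  show "0 \<le> ?A + (\<Sum>j<r. ?t j)" using A B by simp
  fix x assume "x \<in> {c 0..c r}"
  then consider i where "i \<le> r" "x = c i" | j where "j < r" "x \<in> {c j<..<c (Suc j)}"
    using partition_cases by blast
  then show "\<bar>f x\<bar> \<le> ?A + (\<Sum>j<r. ?t j)"
  proof cases
    case 1
    then have "\<bar>f x\<bar> \<le> ?A" by (auto intro!: member_le_sum)
    then show ?thesis using B by simp
  next
    case 2
    then have "\<bar>f x - f (mid j)\<bar> \<le> L * \<bar>x - mid j\<bar>"
      using lipschitz_onD[of L "{c j<..<c (Suc j)}" f x "mid j"] lip by (auto simp: dist_real_def mid_def)
    also have "\<dots> \<le> \<bar>L\<bar> * \<bar>c (Suc j) - c j\<bar>"
      using 2 by (intro mult_mono) (auto simp: mid_def abs_le_iff field_simps)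
    finally have "\<bar>f x\<bar> \<le> ?t j" by linarith
    also have "\<dots> \<le> (\<Sum>j<r. ?t j)" using 2 by (intro member_le_sum) auto
    finally show ?thesis using A by linarith
  qed
qed

text \<open>Extended by \<open>0\<close> outside the interval, the function is continuous off the finitely many breakpoints.\<close>

lemma piecewise_lipschitz_measurable:
  fixes f :: "real \<Rightarrow> real" and c :: "nat \<Rightarrow> real"
  assumes lip: "\<forall>j<r. L-lipschitz_on {c j<..<c (Suc j)} f"
    and inc: "\<forall>j<r. c j < c (Suc j)"
  shows "f \<in> borel_measurable (lebesgue_on {c 0..c r})"
proof -
  define f0 where "f0 x = (if x \<in> {c 0..c r} then f x else 0)" for x
  let ?X = "c ` {..r}"
  have "continuous_on (- ?X) f0"
  proof (rule continuous_at_imp_continuous_on, intro ballI)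
    fix x assume x: "x \<in> - ?X"
    have *: "isCont f0 x" if "open U" "x \<in> U" "continuous_on U g" "\<And>y. y \<in> U \<Longrightarrow> f0 y = g y" for U g
      using that continuous_on_eq_continuous_at[of U f0] continuous_on_cong[of U U f0 g] by auto
    consider "x < c 0" | "x > c r" | j where "j < r" "x \<in> {c j<..<c (Suc j)}"
      using x partition_cases[of x c r] by force
    then show "isCont f0 x"
    proof cases
      case 1
      then show ?thesis by (intro *[of "{..<c 0}" "\<lambda>_. 0"]) (auto simp: f0_def)
    next
      case 2
      then show ?thesis by (intro *[of "{c r<..}" "\<lambda>_. 0"]) (auto simp: f0_def)
    next
      case 3
      then have "{c j<..<c (Suc j)} \<subseteq> {c 0..c r}"
        using partition_mono[OF inc, of 0 j] partition_mono[OF inc, of "Suc j" r] by auto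
      moreover have "continuous_on {c j<..<c (Suc j)} f"
        using lip 3(1) lipschitz_on_continuous_on by blast
      ultimately show ?thesis
        using 3 by (intro *[of "{c j<..<c (Suc j)}" f]) (auto simp: f0_def)
    qed
  qed
  then have "f0 \<in> borel_measurable borel"
    by (rule borel_measurable_continuous_countable_exceptions[rotated]) (auto intro: countable_finite)
  then have "f0 \<in> borel_measurable (lebesgue_on {c 0..c r})"
    by (intro measurable_restrict_space1 measurable_completion) simp
  then show ?thesis
    by (subst measurable_cong[where g = f0]) (auto simp: f0_def)
qed

text \<open>If no breakpoint is within \<open>h\<close> of \<open>x\<close>, then \<open>x\<close> and \<open>y\<close> lie in the same piece and the Lipschitz bound
  applies; otherwise only the crude bound \<open>2 * Mf\<close> is available, and the indicators record the
  set, of measure \<open>O(h)\<close>, on which it has to be used.\<close>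

lemma piecewise_lipschitz_step:
  fixes f :: "real \<Rightarrow> real" and c :: "nat \<Rightarrow> real"
  assumes lip: "\<forall>j<r. L-lipschitz_on {c j<..<c (Suc j)} f"
    and inc: "\<forall>j<r. c j < c (Suc j)" and L: "0 \<le> L"
    and M: "\<And>x. x \<in> {c 0..c r} \<Longrightarrow> \<bar>f x\<bar> \<le> Mf"
    and xy: "x \<in> {c 0..c r}" "y \<in> {c 0..c r}" "\<bar>y - x\<bar> \<le> h"
  shows "\<bar>f y - f x\<bar> \<le> L * h + 2 * Mf * (\<Sum>i\<le>r. indicator {c i - h..c i + h} x)"
proof (cases "\<exists>i\<le>r. x \<in> {c i - h..c i + h}")
  case True
  then obtain i where "i \<le> r" "x \<in> {c i - h..c i + h}" by auto
  then have "1 \<le> (\<Sum>i\<le>r. indicator {c i - h..c i + h} x :: real)"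
    using member_le_sum[of i "{..r}" "\<lambda>i. indicator {c i - h..c i + h} x :: real"] by auto
  moreover have "0 \<le> Mf" using M[OF xy(1)] by linarith
  ultimately have "2 * Mf * 1 \<le> 2 * Mf * (\<Sum>i\<le>r. indicator {c i - h..c i + h} x)"
    by (intro mult_left_mono) auto
  moreover have "\<bar>f y - f x\<bar> \<le> 2 * Mf" using M[OF xy(1)] M[OF xy(2)] by linarith
  moreover have "0 \<le> L * h" using L xy by (intro mult_nonneg_nonneg) auto
  ultimately show ?thesis by linarith
next
  case False
  have h: "0 \<le> h" using xy by auto
  with False have "x \<noteq> c i" if "i \<le> r" for i using that by fastforce
  then obtain j where j: "j < r" "x \<in> {c j<..<c (Suc j)}" using partition_cases[OF xy(1)] by auto
  have "x \<notin> {c j - h..c j + h}" "x \<notin> {c (Suc j) - h..c (Suc j) + h}" using False j by auto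
  then have y: "y \<in> {c j<..<c (Suc j)}" using j xy by auto
  have "\<bar>f y - f x\<bar> \<le> L * \<bar>y - x\<bar>"
    using lipschitz_onD[of L "{c j<..<c (Suc j)}" f y x] lip j y by (auto simp: dist_real_def)
  also have "\<dots> \<le> L * h" using xy L by (intro mult_left_mono) auto
  finally have "\<bar>f y - f x\<bar> \<le> L * h" .
  moreover have "(\<Sum>i\<le>r. indicator {c i - h..c i + h} x) = (0 :: real)"
    using False by (intro sum.neutral) (auto simp: indicator_def)
  ultimately show ?thesis by simp
qed

section \<open>Continuous and discrete Volterra operators\<close>

lemma volterra_eq_integral:
  fixes f :: "real \<Rightarrow> real"
  assumes f: "f \<in> borel_measurable (lebesgue_on {a..b})" and M: "\<And>x. x \<in> {a..b} \<Longrightarrow> \<bar>f x\<bar> \<le> Mf"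
    and x: "x \<in> {a..b}"
  shows "f integrable_on {a..x}" "volterra a f x = integral {a..x} f"
proof -
  have "integrable (lebesgue_on {a..x}) f"
    using x M by (intro integrable_lebesgue_on_bounded[where H = Mf] measurable_restrict_mono[OF f]) auto
  from has_integral_integral_lebesgue_on[OF this]
  have *: "(f has_integral volterra a f x) {a..x}" by (simp add: volterra_def)
  then show "f integrable_on {a..x}" "volterra a f x = integral {a..x} f"
    by (auto simp: integral_unique has_integral_integrable)
qed

lemma volterra_lipschitz:
  fixes f :: "real \<Rightarrow> real"
  assumes f: "f \<in> borel_measurable (lebesgue_on {a..b})" and M: "\<And>x. x \<in> {a..b} \<Longrightarrow> \<bar>f x\<bar> \<le> Mf"
    and Mf: "0 \<le> Mf"
  shows "Mf-lipschitz_on {a..b} (volterra a f)"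
proof (rule lipschitz_onI[OF _ Mf])
  have *: "\<bar>volterra a f y - volterra a f x\<bar> \<le> Mf * (y - x)" if xy: "x \<in> {a..b}" "y \<in> {a..b}" "x \<le> y" for x y
  proof -
    have int: "f integrable_on {x..y}"
      using volterra_eq_integral(1)[OF f M xy(2)] by (rule integrable_on_subinterval) (use xy in auto)
    have "volterra a f y - volterra a f x = integral {x..y} f"
      using Henstock_Kurzweil_Integration.integral_combine[OF _ xy(3) volterra_eq_integral(1)[OF f M xy(2)]] xy
        volterra_eq_integral(2)[OF f M xy(1)] volterra_eq_integral(2)[OF f M xy(2)] by simp
    moreover have "norm (integral {x..y} f) \<le> integral {x..y} (\<lambda>_. Mf)"
      using M xy by (intro integral_norm_bound_integral int) auto
    ultimately show ?thesis using xy by (simp add: mult.commute)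
  qed
  fix x y assume "x \<in> {a..b}" "y \<in> {a..b}"
  then show "dist (volterra a f x) (volterra a f y) \<le> Mf * dist x y"
    using *[of x y] *[of y x] by (cases "x \<le> y") (auto simp: dist_real_def abs_minus_commute)
qed

text \<open>Centering subtracts from the antiderivative the linear function with the same end value. The
  discrete operator behaves in the same way at the nodes, so the centred case reduces to the
  uncentred one at the cost of a factor \<open>2\<close>.\<close>

lemma volterra_cen:
  fixes f :: "real \<Rightarrow> real"
  assumes ab: "a < b"
    and f: "f \<in> borel_measurable (lebesgue_on {a..b})" and M: "\<And>x. x \<in> {a..b} \<Longrightarrow> \<bar>f x\<bar> \<le> Mf"
    and x: "x \<in> {a..b}"
  shows "volterra a (cen a b f) x = volterra a f x - (x - a) / (b - a) * volterra a f b"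
proof -
  let ?m = "mean a b f"
  have meas: "cen a b f \<in> borel_measurable (lebesgue_on {a..b})"
    using f unfolding cen_def by measurable
  have bd: "\<bar>cen a b f y\<bar> \<le> Mf + \<bar>?m\<bar>" if "y \<in> {a..b}" for y
    using M[OF that] unfolding cen_def by linarith
  have "volterra a (cen a b f) x = integral {a..x} (\<lambda>y. f y - ?m)"
    by (subst volterra_eq_integral(2)[OF meas bd x]) (simp_all add: cen_def[abs_def])
  also have "\<dots> = volterra a f x - (x - a) * ?m"
    using Henstock_Kurzweil_Integration.integral_diff[OF volterra_eq_integral(1)[OF f M x] integrable_const_ivl, of ?m]
      volterra_eq_integral(2)[OF f M x] x by simp
  finally show ?thesis using ab by (simp add: mean_def volterra_def)
qed

lemma dvolterra_dcen:
  assumes n: "1 \<le> n"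
  shows "dvolterra a b n (dcen n w) k = dvolterra a b n w k - real k / real n * dvolterra a b n w n"
proof -
  have "(\<Sum>j<k. dcen n w j + dcen n w (Suc j)) = (\<Sum>j<k. w j + w (Suc j)) - 2 * real k * dmean n w"
    by (simp add: dcen_def sum.distrib sum_subtractf algebra_simps)
  moreover have "dvolterra a b n w n = (b - a) * dmean n w" by (simp add: dvolterra_def dmean_def)
  ultimately show ?thesis using n by (simp add: dvolterra_def right_diff_distrib)
qed

text \<open>The trapezoid sum is a combination of three partial sums, over \<open>j < k\<close>, \<open>j < k + 1\<close> and \<open>j < 1\<close>.\<close>

lemma abs_dvolterra_le:
  assumes ab: "a < b" and n: "1 \<le> n" and k: "k \<le> n"
    and S: "\<And>m. m \<le> Suc n \<Longrightarrow> \<bar>\<Sum>j<m. z j\<bar> \<le> S"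
  shows "\<bar>dvolterra a b n z k\<bar> \<le> 3 / 2 * (b - a) * S / real n"
proof -
  have "(\<Sum>j<k. z (Suc j)) = (\<Sum>j<Suc k. z j) - (\<Sum>j<1. z j)"
    by (subst sum.lessThan_Suc_shift) simp
  then have "(\<Sum>j<k. z j + z (Suc j)) = (\<Sum>j<k. z j) + (\<Sum>j<Suc k. z j) - (\<Sum>j<1. z j)"
    by (simp only: sum.distrib)
  then have "\<bar>\<Sum>j<k. z j + z (Suc j)\<bar> \<le> 3 * S"
    using S[of k] S[of "Suc k"] S[of 1] k n by linarith
  then have "(b - a) / (2 * real n) * \<bar>\<Sum>j<k. z j + z (Suc j)\<bar> \<le> (b - a) / (2 * real n) * (3 * S)"
    using ab by (intro mult_left_mono) auto
  moreover have "\<bar>dvolterra a b n z k\<bar> = (b - a) / (2 * real n) * \<bar>\<Sum>j<k. z j + z (Suc j)\<bar>"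
    using ab by (simp add: dvolterra_def abs_mult)
  ultimately show ?thesis by (simp add: algebra_simps)
qed

lemma dvolterra_noisy:
  "dvolterra a b n (noisy a b n f z) k = dvolterra a b n (sample a b n f) k + dvolterra a b n z k"
  by (simp add: dvolterra_def noisy_def sum.distrib algebra_simps)

text \<open>The error is the integral of (step function of the samples) \<open>- f\<close>, which is at most \<open>L * h\<close> except
  near the \<open>r + 1\<close> breakpoints; those contribute at most \<open>2 * Mf\<close> on intervals of length \<open>2 * h\<close>.\<close>

lemma trapezoid_error:
  fixes f :: "real \<Rightarrow> real" and c :: "nat \<Rightarrow> real"
  assumes lip: "\<forall>j<r. L-lipschitz_on {c j<..<c (Suc j)} f"
    and inc: "\<forall>j<r. c j < c (Suc j)" and L: "0 \<le> L"
    and c: "c 0 = a" "c r = b" and ab: "a < b"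
    and M: "\<And>x. x \<in> {a..b} \<Longrightarrow> \<bar>f x\<bar> \<le> Mf"
    and n: "1 \<le> n" and k: "k \<le> n"
  shows "\<bar>dvolterra a b n (sample a b n f) k - volterra a f (grid_node a b n k)\<bar>
    \<le> (L * (b - a) + 4 * Mf * real (Suc r)) * (b - a) / real n"
proof -
  let ?x = "grid_node a b n k"
  define h where "h = (b - a) / real n"
  have h: "0 < h" using ab n by (simp add: h_def)
  let ?G = "nearest_node_step a b n (sample a b n f)"
  let ?B = "\<lambda>i. {c i - h..c i + h}"
  let ?\<psi> = "\<lambda>x. L * h + 2 * Mf * (\<Sum>i\<le>r. indicator (?B i) x)"
  have Mf: "0 \<le> Mf" using M[of a] ab by force
  have x: "?x \<in> {a..b}" using grid_node_in[OF ab n k] .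
  have f: "f \<in> borel_measurable (lebesgue_on {a..b})"
    using piecewise_lipschitz_measurable[OF lip inc] c by simp
  have V: "f integrable_on {a..?x}" "volterra a f ?x = integral {a..?x} f"
    using volterra_eq_integral[OF f M x] by auto
  note G = has_integral_nearest_node_step[OF ab n, of "sample a b n f" k]
  have Bint: "(indicator (?B i) has_integral measure lebesgue (?B i \<inter> {a..?x})) {a..?x}" for i
  proof -
    have "?B i \<inter> {a..?x} \<in> lmeasurable" by (simp add: Int_atLeastAtMost)
    then have "(indicator (?B i \<inter> {a..?x}) has_integral measure lebesgue (?B i \<inter> {a..?x})) UNIV"
      by (simp only: lmeasurable_iff_indicator_has_integral[symmetric])
    then have "((\<lambda>y. if y \<in> {a..?x} then indicator (?B i) y else 0 :: real) has_integral measure lebesgue (?B i \<inter> {a..?x})) UNIV"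
      by (rule has_integral_eq[rotated]) (auto simp: indicator_def)
    then show ?thesis by (simp only: has_integral_restrict_UNIV)
  qed
  have \<psi>: "(?\<psi> has_integral measure lborel {a..?x} *\<^sub>R (L * h) + 2 * Mf * (\<Sum>i\<le>r. measure lebesgue (?B i \<inter> {a..?x}))) {a..?x}"
    by (intro has_integral_add has_integral_const_real has_integral_mult_right has_integral_sum Bint) auto
  have le: "norm (?G y - f y) \<le> ?\<psi> y" if y: "y \<in> {a..?x}" for y
  proof -
    have yab: "y \<in> {a..b}" using y x by auto
    then obtain i where i: "?G y = sample a b n f i" "\<bar>grid_node a b n i - y\<bar> \<le> h" "grid_node a b n i \<in> {a..b}"
      using nearest_node_exists[OF ab n yab] unfolding h_def by metis
    then show ?thesis
      using piecewise_lipschitz_step[OF lip inc L, of Mf y "grid_node a b n i" h] M yab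
      unfolding c by (simp add: sample_def)
  qed
  have "dvolterra a b n (sample a b n f) k - volterra a f ?x = integral {a..?x} (\<lambda>y. ?G y - f y)"
    using G V by (simp add: Henstock_Kurzweil_Integration.integral_diff has_integral_integrable_integral)
  also have "\<bar>\<dots>\<bar> \<le> integral {a..?x} ?\<psi>"
    using integral_norm_bound_integral[OF integrable_diff[OF has_integral_integrable[OF G] V(1)] has_integral_integrable[OF \<psi>] le]
    by simp
  also have "\<dots> = (?x - a) * (L * h) + 2 * Mf * (\<Sum>i\<le>r. measure lebesgue (?B i \<inter> {a..?x}))"
    using integral_unique[OF \<psi>] x by simp
  also have "\<dots> \<le> (b - a) * (L * h) + 2 * Mf * (\<Sum>i\<le>r. 2 * h)"
  proof (intro add_mono mult_right_mono mult_left_mono sum_mono)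
    fix i
    have "measure lebesgue (?B i \<inter> {a..?x}) \<le> measure lebesgue (?B i)"
      by (intro measure_mono_fmeasurable) auto
    also have "\<dots> = 2 * h" using h by simp
    finally show "measure lebesgue (?B i \<inter> {a..?x}) \<le> 2 * h" .
  qed (use x L h Mf in auto)
  also have "\<dots> = (L * (b - a) + 4 * Mf * real (Suc r)) * h" by (simp add: algebra_simps)
  finally show ?thesis by (simp add: h_def)
qed

text \<open>The deterministic core. The discrete Volterra vector of the data differs from \<open>volterra a f\<close> at
  the nodes by the trapezoid error and the noise, and the norms of uniformly close functions are close.
  The factor in front of \<open>S\<close> depends on the interval alone; everything that depends on \<open>f\<close> sits in \<open>E\<close>.\<close>

lemma noisy_volterra_norm_error:
  fixes f :: "real \<Rightarrow> real" and c :: "nat \<Rightarrow> real"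
  assumes lip: "\<forall>j<r. L-lipschitz_on {c j<..<c (Suc j)} f"
    and inc: "\<forall>j<r. c j < c (Suc j)" and L: "0 \<le> L"
    and c: "c 0 = a" "c r = b" and ab: "a < b"
  obtains E where
    "\<And>(n :: nat) (z :: nat \<Rightarrow> real) (S :: real) (p :: ennreal). \<lbrakk>1 \<le> n; 1 \<le> p; \<And>m. m \<le> Suc n \<Longrightarrow> \<bar>\<Sum>j<m. z j\<bar> \<le> S\<rbrakk> \<Longrightarrow>
      \<bar>nu_norm a b n p (noisy a b n f z) - volterra_norm a b p f\<bar>
        \<le> (3 * max 1 (b - a) * (b - a) * S + E) / real n \<and>
      \<bar>nu_norm a b n p (dcen n (noisy a b n f z)) - volterra_norm a b p (cen a b f)\<bar>
        \<le> (3 * max 1 (b - a) * (b - a) * S + E) / real n"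
proof -
  let ?K = "max 1 (b - a)"
  obtain Mf where Mf: "0 \<le> Mf" and M: "\<And>x. x \<in> {a..b} \<Longrightarrow> \<bar>f x\<bar> \<le> Mf"
    using piecewise_lipschitz_bounded[OF lip] c by metis
  have f: "f \<in> borel_measurable (lebesgue_on {a..b})"
    using piecewise_lipschitz_measurable[OF lip inc] c by simp
  let ?V = "volterra a f"
  have lipV: "Mf-lipschitz_on {a..b} ?V" by (rule volterra_lipschitz[OF f M Mf])
  have Vcen: "volterra a (cen a b f) x = ?V x - (x - a) / (b - a) * ?V b" if "x \<in> {a..b}" for x
    by (rule volterra_cen[OF ab f M that])
  define T where "T = (L * (b - a) + 4 * Mf * real (Suc r)) * (b - a)"
  have lipC: "(2 * Mf)-lipschitz_on {a..b} (volterra a (cen a b f))"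
  proof (rule lipschitz_onI)
    fix x y assume xy: "x \<in> {a..b}" "y \<in> {a..b}"
    have "?V a = 0" using volterra_eq_integral(2)[OF f M, of a] ab by simp
    then have "\<bar>?V b\<bar> \<le> Mf * (b - a)"
      using lipschitz_onD[OF lipV, of b a] ab by (simp add: dist_real_def)
    then have "\<bar>(x - y) / (b - a) * ?V b\<bar> \<le> \<bar>(x - y) / (b - a)\<bar> * (Mf * (b - a))"
      unfolding abs_mult by (rule mult_left_mono) simp
    also have "\<dots> = Mf * \<bar>x - y\<bar>" using ab by (simp add: abs_divide)
    finally have "\<bar>(x - y) / (b - a) * ?V b\<bar> \<le> Mf * \<bar>x - y\<bar>" .
    moreover have "\<bar>?V x - ?V y\<bar> \<le> Mf * \<bar>x - y\<bar>"
      using lipschitz_onD[OF lipV xy] by (simp add: dist_real_def)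
    moreover have "volterra a (cen a b f) x - volterra a (cen a b f) y = (?V x - ?V y) - (x - y) / (b - a) * ?V b"
      unfolding Vcen[OF xy(1)] Vcen[OF xy(2)] by (simp add: algebra_simps diff_divide_distrib)
    ultimately have "\<bar>volterra a (cen a b f) x - volterra a (cen a b f) y\<bar> \<le> Mf * \<bar>x - y\<bar> + Mf * \<bar>x - y\<bar>"
      by (simp only:) (rule order_trans[OF abs_triangle_ineq4 add_mono])
    then show "dist (volterra a (cen a b f) x) (volterra a (cen a b f) y) \<le> 2 * Mf * dist x y"
      by (simp add: dist_real_def)
  qed (use Mf in simp)
  have lipV2: "(2 * Mf)-lipschitz_on {a..b} ?V" using lipV by (rule lipschitz_on_mono) (use Mf in auto)
  show thesis
  proof (rule that[of "?K * (2 * T + 2 * Mf * (b - a))"])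
    fix n :: nat and z :: "nat \<Rightarrow> real" and S :: real and p :: ennreal
    assume n: "1 \<le> n" and p: "1 \<le> p" and S: "\<And>m. m \<le> Suc n \<Longrightarrow> \<bar>\<Sum>j<m. z j\<bar> \<le> S"
    \<comment> \<open>Uniform bound for the uncentred vector; centering doubles it, because the linear correction
      inherits at most the error at the last node.\<close>
    define \<delta> where "\<delta> = T / real n + 3 / 2 * (b - a) * S / real n"
    define v where "v = dvolterra a b n (noisy a b n f z)"
    have v: "\<bar>v k - ?V (grid_node a b n k)\<bar> \<le> \<delta>" if "k \<le> n" for k
      using trapezoid_error[OF lip inc L c ab M n that] abs_dvolterra_le[OF ab n that S]
      unfolding \<delta>_def v_def dvolterra_noisy T_def by linarith
    have \<delta>: "0 \<le> \<delta>" using v[of 0] by (meson abs_ge_zero le0 order_trans)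
    have v2: "\<bar>v k - ?V (grid_node a b n k)\<bar> \<le> 2 * \<delta>" if "k \<le> n" for k
      using v[OF that] \<delta> by linarith
    have w: "\<bar>dvolterra a b n (dcen n (noisy a b n f z)) k - volterra a (cen a b f) (grid_node a b n k)\<bar> \<le> 2 * \<delta>"
      if k: "k \<le> n" for k
    proof -
      have nd: "grid_node a b n n = b" using n by simp
      have "(grid_node a b n k - a) / (b - a) = real k / real n" using ab by simp
      then have "dvolterra a b n (dcen n (noisy a b n f z)) k - volterra a (cen a b f) (grid_node a b n k)
          = (v k - ?V (grid_node a b n k)) - real k / real n * (v n - ?V b)"
        unfolding dvolterra_dcen[OF n] Vcen[OF grid_node_in[OF ab n k]] v_def[symmetric]
        by (simp add: algebra_simps)
      moreover have "\<bar>real k / real n * (v n - ?V b)\<bar> \<le> 1 * \<delta>"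
        using v[of n] k n unfolding abs_mult nd by (intro mult_mono) auto
      moreover have "\<bar>v k - ?V (grid_node a b n k)\<bar> \<le> 1 * \<delta>" using v[OF k] by simp
      ultimately have "\<bar>dvolterra a b n (dcen n (noisy a b n f z)) k - volterra a (cen a b f) (grid_node a b n k)\<bar>
          \<le> 1 * \<delta> + 1 * \<delta>"
        by (simp only:) (rule order_trans[OF abs_triangle_ineq4 add_mono])
      then show ?thesis by simp
    qed
    have eq: "?K * (2 * \<delta> + 2 * Mf * (b - a) / real n)
        = (3 * ?K * (b - a) * S + ?K * (2 * T + 2 * Mf * (b - a))) / real n"
    proof -
      have "K * (2 * (T / N + 3 / 2 * l * S / N) + 2 * Mf * l / N) = (3 * K * l * S + K * (2 * T + 2 * Mf * l)) / N"
        if "N \<noteq> 0" for K l N :: real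
        using that by (simp add: field_simps)
      from this[of "real n" ?K "b - a"] show ?thesis using n unfolding \<delta>_def by simp
    qed
    show "\<bar>nu_norm a b n p (noisy a b n f z) - volterra_norm a b p f\<bar>
        \<le> (3 * ?K * (b - a) * S + ?K * (2 * T + 2 * Mf * (b - a))) / real n \<and>
      \<bar>nu_norm a b n p (dcen n (noisy a b n f z)) - volterra_norm a b p (cen a b f)\<bar>
        \<le> (3 * ?K * (b - a) * S + ?K * (2 * T + 2 * Mf * (b - a))) / real n"
      using tau_norm_Lp_norm_close[OF ab n p lipV2 v2] tau_norm_Lp_norm_close[OF ab n p lipC w]
      unfolding eq nu_norm_def volterra_norm_def v_def by simp
  qed
qed

lemma measurable_nu_norm:
  assumes [measurable]: "\<And>k. (\<lambda>\<omega>. x \<omega> k) \<in> borel_measurable M"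
  shows "(\<lambda>\<omega>. nu_norm a b n p (x \<omega>)) \<in> borel_measurable M"
  by (cases "p = \<infinity>") (simp_all add: nu_norm_def tau_norm_def dvolterra_def)

section \<open>Consistency of the noisy Volterra norm\<close>

theorem corollary5p4:
  shows "\<exists>A>0. \<forall>a b :: real. a < b \<longrightarrow> (\<exists>B>0. \<exists>C>0.
    \<forall>(r :: nat) (c :: nat \<Rightarrow> real) (f :: real \<Rightarrow> real) (L :: real)
      (M :: 'w measure) (Z :: nat \<Rightarrow> 'w \<Rightarrow> real) (s :: nat \<Rightarrow> real) (\<sigma> :: real) (p :: ennreal).
      c 0 = a \<and> c r = b \<and> (\<forall>j<r. c j < c (Suc j)) \<and>
      L > 0 \<and> (\<forall>j<r. L-lipschitz_on {c j<..<c (Suc j)} f) \<and>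
      prob_space M \<and>
      (\<forall>j. s j > 0) \<and>
      prob_space.indep_vars M (\<lambda>_. borel) Z UNIV \<and>
      (\<forall>j. distributed M lborel (Z j) (normal_density 0 (s j))) \<and>
      \<sigma> > 0 \<and> (\<forall>n\<ge>1. 1 / real n * (\<Sum>j=1..n. (s j)\<^sup>2) \<le> \<sigma>\<^sup>2) \<and>
      1 \<le> p
      \<longrightarrow>
      ((\<forall>t>0. \<forall>\<^sub>F n in sequentially.
          measure M {\<omega> \<in> space M.
            \<bar>nu_norm a b n p (noisy a b n f (\<lambda>k. Z k \<omega>)) - volterra_norm a b p f\<bar> \<ge> t}
          \<le> A * exp (- B * t\<^sup>2 * real n / \<sigma>\<^sup>2)) \<and>
       (AE \<omega> in M.
          (\<lambda>n. nu_norm a b n p (noisy a b n f (\<lambda>k. Z k \<omega>))) \<longlonglongrightarrow> volterra_norm a b p f) \<and>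
       (\<forall>\<^sub>F n in sequentially.
          integrable M (\<lambda>\<omega>.
            \<bar>nu_norm a b n p (noisy a b n f (\<lambda>k. Z k \<omega>)) - volterra_norm a b p f\<bar>) \<and>
          (LINT \<omega>|M.
            \<bar>nu_norm a b n p (noisy a b n f (\<lambda>k. Z k \<omega>)) - volterra_norm a b p f\<bar>)
          \<le> C * (\<sigma> / sqrt (real n)))) \<and>
      ((\<forall>t>0. \<forall>\<^sub>F n in sequentially.
          measure M {\<omega> \<in> space M.
            \<bar>nu_norm a b n p (dcen n (noisy a b n f (\<lambda>k. Z k \<omega>)))
              - volterra_norm a b p (cen a b f)\<bar> \<ge> t}
          \<le> A * exp (- B * t\<^sup>2 * real n / \<sigma>\<^sup>2)) \<and>
       (AE \<omega> in M.
          (\<lambda>n. nu_norm a b n p (dcen n (noisy a b n f (\<lambda>k. Z k \<omega>))))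
            \<longlonglongrightarrow> volterra_norm a b p (cen a b f)) \<and>
       (\<forall>\<^sub>F n in sequentially.
          integrable M (\<lambda>\<omega>.
            \<bar>nu_norm a b n p (dcen n (noisy a b n f (\<lambda>k. Z k \<omega>)))
              - volterra_norm a b p (cen a b f)\<bar>) \<and>
          (LINT \<omega>|M.
            \<bar>nu_norm a b n p (dcen n (noisy a b n f (\<lambda>k. Z k \<omega>)))
              - volterra_norm a b p (cen a b f)\<bar>)
          \<le> C * (\<sigma> / sqrt (real n)))))"
  apply (rule exI[of _ 4], rule conjI, simp, intro allI impI)
  subgoal premises ab for a b
    apply (rule exI[of _ "1 / (16 * (3 * max 1 (b - a) * (b - a))\<^sup>2)"], rule conjI)
    subgoal using ab by simp
    apply (rule exI[of _ "16 * (3 * max 1 (b - a) * (b - a)) + 1"], rule conjI)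
    subgoal using ab by (simp add: add_nonneg_pos)
    apply (intro allI impI)
    subgoal premises hyps for r c f L M Z s \<sigma> p
    proof -
      let ?\<kappa> = "3 * max 1 (b - a) * (b - a)"
      have \<kappa>: "0 < ?\<kappa>" using ab by simp
      interpret prob_space M using hyps by blast
      have ind: "indep_vars (\<lambda>_. borel) Z UNIV"
        and nor: "\<And>j. distributed M lborel (Z j) (normal_density 0 (s j))"
        and s: "\<And>j. 0 < s j" and \<sigma>: "0 < \<sigma>" and p: "1 \<le> p"
        and var: "\<And>n. 1 \<le> n \<Longrightarrow> 1 / real n * (\<Sum>j=1..n. (s j)\<^sup>2) \<le> \<sigma>\<^sup>2"
        and lip: "\<forall>j<r. L-lipschitz_on {c j<..<c (Suc j)} f"
        and inc: "\<forall>j<r. c j < c (Suc j)" and L: "0 \<le> L" and c: "c 0 = a" "c r = b"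
        using hyps by auto
      have [measurable]: "Z j \<in> borel_measurable M" for j
        using ind by (auto simp: indep_vars_def)
      have meas: "(\<lambda>\<omega>. noisy a b n f (\<lambda>k. Z k \<omega>) k) \<in> borel_measurable M"
        "(\<lambda>\<omega>. dcen n (noisy a b n f (\<lambda>k. Z k \<omega>)) k) \<in> borel_measurable M" for n k
        by (simp_all add: noisy_def dcen_def dmean_def)
      obtain E where E: "\<And>(n :: nat) (z :: nat \<Rightarrow> real) (S :: real) (p :: ennreal).
          \<lbrakk>1 \<le> n; 1 \<le> p; \<And>m. m \<le> Suc n \<Longrightarrow> \<bar>\<Sum>j<m. z j\<bar> \<le> S\<rbrakk> \<Longrightarrow>
        \<bar>nu_norm a b n p (noisy a b n f z) - volterra_norm a b p f\<bar> \<le> (?\<kappa> * S + E) / real n \<and>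
        \<bar>nu_norm a b n p (dcen n (noisy a b n f z)) - volterra_norm a b p (cen a b f)\<bar> \<le> (?\<kappa> * S + E) / real n"
        using noisy_volterra_norm_error[OF lip inc L c ab] by blast
      show ?thesis
        by (intro conjI[OF
              gaussian_walk_controlled_convergence[OF ind nor s \<sigma> var \<kappa> measurable_nu_norm[OF meas(1)]]
              gaussian_walk_controlled_convergence[OF ind nor s \<sigma> var \<kappa> measurable_nu_norm[OF meas(2)]]])
          (use E[OF _ p] in blast)+
    qed
    done
  done

end
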